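(* For every $\alpha>0$ and $x\in(0,1)$ there exists a positive constant $C$, depending on $\alpha$ and $x$, such that $$\sup_{z\in\mathbb{R}}\left|\widetilde F_{\alpha,x}^{(n)}(z)-\Phi(z)\right|\le\frac{C}{\sqrt n},\qquad n\in\mathbb{N},$$ where $\widetilde F_{\alpha,x}^{(n)}(z)=\mathbb{P}(\widetilde S_{\alpha,x}^{(n)}\le z)$ is the distribution function of $$\widetilde S_{\alpha,x}^{(n)}:=\frac{S_{\alpha,x}^{(n)}-\mathbb{E}[S_{\alpha,x}^{(n)}]}{\sqrt{\mathrm{Var}(S_{\alpha,x}^{(n)})}},$$ $S_{\alpha,x}^{(n)}$ is a random variable whose law is the $\alpha$-fractional binomial distribution $\mu_{\alpha,x}^{(n)}$, and $\Phi(z)=\int_{-\infty}^z\frac{1}{\sqrt{2\pi}}e^{-u^2/2}\,\mathrm{d}u$ is the distribution function of the standard normal distribution $N(0,1)$.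
   Context: $\mathbb{N}=\{1,2,3,\dots\}$. For real $w>-1$ and $z$ with $-1<z<w+1$, $\binom{w}{z}:=\frac{\Gamma(w+1)}{\Gamma(z+1)\Gamma(w-z+1)}$, where $\Gamma$ is the gamma function. For $\alpha>0$, $n\in\mathbb{N}$, $x\in[0,1]$, the $\alpha$-fractional binomial distribution $\mu_{\alpha,x}^{(n)}$ is the probability measure on $\{0,1,\dots,n\}$ defined by $$\mu_{\alpha,x}^{(n)}=\frac{\alpha}{Z_{\alpha,x}^{(n)}}\sum_{j=0}^n\binom{\alpha n}{\alpha j}x^{\alpha j}(1-x)^{\alpha(n-j)}\delta_j,\qquad Z_{\alpha,x}^{(n)}=\alpha\sum_{j=0}^n\binom{\alpha n}{\alpha j}x^{\alpha j}(1-x)^{\alpha(n-j)},$$ where $\delta_j$ is the Dirac measure at $j$ (and $0^0=1$). *)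

theory Defs
  imports "HOL-Probability.Probability"
begin

text \<open>The library's \<open>gchoose\<close> only allows a natural number as lower argument.
  This formula is meaningful for \<open>w > -1\<close> and \<open>-1 < z < w + 1\<close>.\<close>

definition real_binomial :: "real \<Rightarrow> real \<Rightarrow> real" where
  "real_binomial w z = Gamma (w + 1) / (Gamma (z + 1) * Gamma (w - z + 1))"

text \<open>Real powers of nonnegative reals with the convention \<open>0\<^sup>0 = 1\<close>
  (whereas \<open>0 powr 0 = 0\<close>).\<close>

definition rpow :: "real \<Rightarrow> real \<Rightarrow> real" where
  "rpow x a = (if a = 0 then 1 else x powr a)"

definition frac_binomial_weight :: "real \<Rightarrow> real \<Rightarrow> nat \<Rightarrow> nat \<Rightarrow> real" where
  "frac_binomial_weight \<alpha> x n j =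
     real_binomial (\<alpha> * real n) (\<alpha> * real j) *
     rpow x (\<alpha> * real j) * rpow (1 - x) (\<alpha> * (real n - real j))"

definition frac_binomial_Z :: "real \<Rightarrow> real \<Rightarrow> nat \<Rightarrow> real" where
  "frac_binomial_Z \<alpha> x n = \<alpha> * (\<Sum>j=0..n. frac_binomial_weight \<alpha> x n j)"

text \<open>For \<open>\<alpha> > 0\<close> and \<open>0 \<le> x \<le> 1\<close> this is the distribution with the indicated mass function,
  see \<open>pmf_frac_binomial_pmf\<close> below; other parameters are irrelevant.\<close>

definition frac_binomial_pmf :: "real \<Rightarrow> real \<Rightarrow> nat \<Rightarrow> nat pmf" where
  "frac_binomial_pmf \<alpha> x n = embed_pmf
     (\<lambda>j. if j \<le> n then \<alpha> / frac_binomial_Z \<alpha> x n * frac_binomial_weight \<alpha> x n j else 0)"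

lemma frac_binomial_weight_nonneg:
  assumes "\<alpha> > 0" "j \<le> n"
  shows "frac_binomial_weight \<alpha> x n j \<ge> 0"
proof -
  have "\<alpha> * real n - \<alpha> * real j \<ge> 0" using assms by simp
  moreover have "\<alpha> * real n \<ge> 0" "\<alpha> * real j \<ge> 0" using assms by simp_all
  ultimately have "Gamma (\<alpha> * real n + 1) > 0" "Gamma (\<alpha> * real j + 1) > 0"
    "Gamma (\<alpha> * real n - \<alpha> * real j + 1) > 0"
    by (simp_all add: Gamma_real_pos)
  then show ?thesis
    by (auto simp: frac_binomial_weight_def real_binomial_def rpow_def)
qed

lemma frac_binomial_Z_pos:
  assumes "\<alpha> > 0" "0 \<le> x" "x \<le> 1"
  shows "frac_binomial_Z \<alpha> x n > 0"
proof -
  have G: "Gamma (\<alpha> * real n + 1) > 0" using assms by (intro Gamma_real_pos) (simp add: add_nonneg_pos)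
  define k where "k = (if x = 1 then n else 0)"
  have "frac_binomial_weight \<alpha> x n k > 0"
    using assms G by (auto simp: frac_binomial_weight_def real_binomial_def rpow_def k_def)
  then have "(\<Sum>j=0..n. frac_binomial_weight \<alpha> x n j) > 0"
    by (intro sum_pos2[where i = k]) (auto simp: k_def intro!: frac_binomial_weight_nonneg assms)
  then show ?thesis using assms by (simp add: frac_binomial_Z_def)
qed

lemma pmf_frac_binomial_pmf:
  assumes "\<alpha> > 0" "0 \<le> x" "x \<le> 1"
  shows "pmf (frac_binomial_pmf \<alpha> x n) j =
    (if j \<le> n then \<alpha> / frac_binomial_Z \<alpha> x n * frac_binomial_weight \<alpha> x n j else 0)"
proof -
  define f where "f = (\<lambda>j. if j \<le> n then
    \<alpha> / frac_binomial_Z \<alpha> x n * frac_binomial_weight \<alpha> x n j else 0)"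
  have Z: "frac_binomial_Z \<alpha> x n > 0" by (rule frac_binomial_Z_pos[OF assms])
  have f0: "f j \<ge> 0" for j
    using Z assms frac_binomial_weight_nonneg[of \<alpha> j n x] by (simp add: f_def)
  have "(\<integral>\<^sup>+j. ennreal (f j) \<partial>count_space UNIV) = (\<Sum>j\<in>{0..n}. ennreal (f j))"
    by (rule nn_integral_count_space'[OF finite_atLeastAtMost]) (auto simp: f_def)
  also have "\<dots> = ennreal (\<Sum>j\<in>{0..n}. f j)"
    by (rule sum_ennreal) (rule f0)
  also have "(\<Sum>j\<in>{0..n}. f j) = (\<Sum>j\<in>{0..n}. \<alpha> / frac_binomial_Z \<alpha> x n * frac_binomial_weight \<alpha> x n j)"
    by (rule sum.cong) (auto simp: f_def)
  also have "\<dots> = \<alpha> / frac_binomial_Z \<alpha> x n * (\<Sum>j=0..n. frac_binomial_weight \<alpha> x n j)"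
    by (simp only: sum_distrib_left)
  also have "\<dots> = 1"
    using Z by (auto simp: frac_binomial_Z_def)
  finally have "pmf (embed_pmf f) j = f j"
    using f0 by (intro pmf_embed_pmf) auto
  then show ?thesis by (simp add: frac_binomial_pmf_def f_def)
qed

definition standardized :: "'a measure \<Rightarrow> ('a \<Rightarrow> real) \<Rightarrow> 'a \<Rightarrow> real" where
  "standardized M X = (\<lambda>\<omega>.
     (X \<omega> - prob_space.expectation M X) / sqrt (prob_space.variance M X))"

definition std_normal_cdf :: "real \<Rightarrow> real" where
  "std_normal_cdf z = (LBINT u:{..z}. 1 / sqrt (2 * pi) * exp (- u\<^sup>2 / 2))"

end

theory Submission
  imports Defs "HOL-Real_Asymp.Real_Asymp"
begin

text \<open>Stein's method. Write \<open>p\<^sub>j\<close> for the masses, \<open>t\<^sub>j = j - n x\<close> and \<open>\<sigma>\<^sup>2 = n x (1 - x) / \<alpha>\<close>.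
  Log-convexity of the Gamma function gives two-sided bounds for \<open>p\<^bsub>j+1\<^esub> / p\<^sub>j\<close>, whence
  \<open>p\<^bsub>j+1\<^esub> - p\<^sub>j = - p\<^sub>j t\<^sub>j / \<sigma>\<^sup>2\<close> up to a relative error \<open>O((1 + t\<^sub>j\<^sup>2 / n) / n)\<close>: a discrete version of
  \<open>\<phi>'(w) = - w \<phi>(w)\<close>. The same bounds make \<open>p\<close> decay away from \<open>n x\<close>, so that the fourth central
  moment is \<open>O(n\<^sup>2)\<close>. Summing the difference equation against \<open>1\<close> and \<open>t\<^bsub>j+1\<^esub>\<close> shows that the mean is
  \<open>n x + O(1)\<close> and the variance \<open>\<sigma>\<^sup>2 + O(\<surd>n)\<close>; summing it against the solution of Stein's equation
  for the indicator of \<open>(-\<infinity>, z]\<close> bounds the distance to the normal distribution function.\<close>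

section \<open>The solution of Stein's equation\<close>

text \<open>The masses enter only through ratios of neighbours, so the normalizing constant cancels.
  In the summed Stein equation the Kolmogorov difference carries the lattice step
  \<open>h = 1 / s\<close> as a factor, with \<open>s\<close> of order sqrt n. Dividing by it costs
  sqrt n, so the total defect of the difference equation has to be O(1/n). Testing against t_{j+1}
  multiplies the error weight w = 1 + t^2 / n by |t| \<le> sqrt n w, so the mean of w^2 must be
  bounded: hence the fourth moment. It also gives p_0 = O(1/n^2), which settles the boundary terms
  at 0. The solution has a kink at \<open>z\<close>. The one lattice step across it has an error of
  order \<open>h\<close> instead of h^2; this is paid for by a bound O(1/sqrt n) on single masses,
  which follows from the same difference equation. The standardization uses the exact mean and
  variance, the difference equation their approximations. Exchanging them costs O(w/n) per unit of
  mass, since the mean is off by O(1) and the variance by a relative error O(1/sqrt n).\<close>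

lemma std_normal_cdf_eq: "std_normal_cdf z = (LBINT u:{..z}. std_normal_density u)"
  by (simp add: std_normal_cdf_def std_normal_density_def)

lemma set_integrable_std_normal:
  "A \<in> sets borel \<Longrightarrow> set_integrable lborel A std_normal_density"
  unfolding set_integrable_def
  by (intro integrable_mult_indicator) (auto intro: integrable_normal_density)

lemma std_normal_cdf_diff:
  assumes "a \<le> b"
  shows "std_normal_cdf b - std_normal_cdf a = (LBINT u:{a<..b}. std_normal_density u)"
proof -
  have eq: "{..b} = {..a} \<union> {a<..b}" using assms by auto
  have "std_normal_cdf b = std_normal_cdf a + (LBINT u:{a<..b}. std_normal_density u)"
    unfolding std_normal_cdf_eq by (subst eq, subst set_integral_Un)
      (auto intro!: set_integrable_std_normal)
  then show ?thesis by simp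
qed

text \<open>Makes limits, bounds and monotonicity instances of general facts about distribution
  functions.\<close>

lemma std_normal_cdf_cdf: "std_normal_cdf = cdf (density lborel std_normal_density)"
proof
  fix z
  have "cdf (density lborel std_normal_density) z
        = measure (density lborel std_normal_density) {..z}" by (simp add: cdf_def)
  also have "\<dots> = (LBINT u:{..z}. std_normal_density u)"
    unfolding measure_def
    by (subst emeasure_density)
       (auto simp: set_lebesgue_integral_def integral_eq_nn_integral ennreal_mult'' mult.commute
             intro!: arg_cong[where f=enn2real] nn_integral_cong split: split_indicator)
  finally show "std_normal_cdf z = cdf (density lborel std_normal_density) z"
    by (simp add: std_normal_cdf_eq)
qed

lemma real_distribution_std_normal: "real_distribution (density lborel std_normal_density)"
  by (simp add: real_distribution_def real_distribution_axioms_def prob_space_normal_density)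

lemma std_normal_cdf_at_top: "(std_normal_cdf \<longlongrightarrow> 1) at_top"
  unfolding std_normal_cdf_cdf
  by (rule real_distribution.cdf_lim_at_top_prob[OF real_distribution_std_normal])

lemma std_normal_cdf_at_bot: "(std_normal_cdf \<longlongrightarrow> 0) at_bot"
  unfolding std_normal_cdf_cdf
  by (rule finite_borel_measure.cdf_lim_at_bot)
     (rule real_distribution.finite_borel_measure_M[OF real_distribution_std_normal])

lemma std_normal_cdf_bounds: "0 \<le> std_normal_cdf z" "std_normal_cdf z \<le> 1"
  unfolding std_normal_cdf_cdf
  by (auto simp: cdf_def intro!: prob_space.prob_le_1[OF prob_space_normal_density])

lemma std_normal_cdf_mono: "mono std_normal_cdf"
  unfolding std_normal_cdf_cdf mono_def
  by (auto intro!: finite_borel_measure.cdf_nondecreasing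
        real_distribution.finite_borel_measure_M[OF real_distribution_std_normal])

lemma std_normal_cdf_deriv:
  "(std_normal_cdf has_real_derivative exp (- w\<^sup>2 / 2) / sqrt (2 * pi)) (at w)"
proof -
  \<comment> \<open>The fundamental theorem of calculus is applied on a compact interval around
    \<open>w\<close>; the mass below its left end is an additive constant.\<close>
  let ?a = "w - 1" and ?b = "w + 1"
  have cont: "continuous_on A std_normal_density" for A
    unfolding std_normal_density_def by (intro continuous_intros) auto
  have "((\<lambda>y. integral {?a..y} std_normal_density) has_real_derivative std_normal_density w)
          (at w within {?a..?b})"
    by (rule integral_has_real_derivative) (auto intro: cont)
  then have "((\<lambda>y. integral {?a..y} std_normal_density) has_real_derivative std_normal_density w) (at w)"
    by (subst (asm) at_within_interior) auto
  then have "((\<lambda>y. std_normal_cdf ?a + integral {?a..y} std_normal_density)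
      has_real_derivative std_normal_density w) (at w)"
    by (auto intro!: derivative_eq_intros)
  then have "(std_normal_cdf has_real_derivative std_normal_density w) (at w)"
  proof (rule DERIV_cong_ev[THEN iffD1, rotated -1, OF _ refl _ refl])
    have "\<forall>\<^sub>F y in nhds w. y > ?a"
      using eventually_nhds_in_open[of "{?a<..}" w] by simp
    then show "\<forall>\<^sub>F y in nhds w. std_normal_cdf ?a + integral {?a..y} std_normal_density = std_normal_cdf y"
    proof eventually_elim
      case (elim y)
      have "std_normal_cdf y - std_normal_cdf ?a = (LBINT u:{?a<..y}. std_normal_density u)"
        using elim by (intro std_normal_cdf_diff) auto
      also have "\<dots> = integral {?a<..y} std_normal_density"
        by (intro set_borel_integral_eq_integral set_integrable_std_normal) auto
      also have "\<dots> = integral {?a..y} std_normal_density"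
        by (intro integral_spike_set) (auto intro: negligible_subset[of "{?a}"])
      finally show ?case by simp
    qed
  qed
  then show ?thesis by (simp add: std_normal_density_def)
qed

section \<open>Gaussian tail bounds\<close>

text \<open>After multiplication by exp (- v^2 / 2), the claimed bound minus the tail is
  \<open>G\<close>, which is nonincreasing and tends to 0, hence is nonnegative. The denominator 1 +
  w instead of w keeps the bound finite at 0.\<close>

lemma std_normal_upper_tail:
  assumes "w \<ge> 0"
  shows "exp (w\<^sup>2 / 2) * (1 - std_normal_cdf w) \<le> 1 / (1 + w)"
proof -
  define G where "G = (\<lambda>v. exp (- v\<^sup>2 / 2) / (1 + v) - (1 - std_normal_cdf v))"
  have G: "G v \<le> G w" if "w \<le> v" for v
  proof (rule DERIV_nonpos_imp_nonincreasing[OF that])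
    fix y assume "w \<le> y" "y \<le> v"
    with assms have y: "y \<ge> 0" by simp
    have d: "(G has_real_derivative
        (exp (- y\<^sup>2 / 2) * (-y) * (1 + y) - exp (- y\<^sup>2 / 2)) / ((1 + y) * (1 + y))
          + exp (- y\<^sup>2 / 2) / sqrt (2 * pi)) (at y)"
      unfolding G_def using y
      by (auto intro!: derivative_eq_intros std_normal_cdf_deriv simp: power2_eq_square)
    \<comment> \<open>Without the factor exp (- y^2 / 2), a nonpositive derivative means 1 / sqrt (2
      pi) \<le> (y (1 + y) + 1) / (1 + y)^2; the number 1/2 separates the two sides.\<close>
    have "sqrt (2 * pi) \<ge> sqrt 4" using pi_gt3 by (intro real_sqrt_le_mono) simp
    then have s: "1 / sqrt (2 * pi) \<le> 1 / 2" by (intro divide_left_mono) auto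
    have "(1 + y) * (1 + y) \<le> 2 * (y * (1 + y) + 1)" using y by (simp add: algebra_simps)
    then have "1 / 2 \<le> (y * (1 + y) + 1) / ((1 + y) * (1 + y))"
      using y by (simp add: divide_simps)
    with s have "exp (- y\<^sup>2 / 2) * (1 / sqrt (2 * pi)) \<le> exp (- y\<^sup>2 / 2) * ((y * (1 + y) + 1) / ((1 + y) * (1 + y)))"
      by (intro mult_left_mono) (linarith, simp)
    moreover have "e * (-y) * (1 + y) - e = - (e * (y * (1 + y) + 1))" for e
      by algebra
    ultimately have "(exp (- y\<^sup>2 / 2) * (-y) * (1 + y) - exp (- y\<^sup>2 / 2)) / ((1 + y) * (1 + y))
          + exp (- y\<^sup>2 / 2) / sqrt (2 * pi) \<le> 0"
      by (simp only: minus_divide_left[symmetric] times_divide_eq_right mult_1_right)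
    with d show "\<exists>D. (G has_real_derivative D) (at y) \<and> D \<le> 0" by blast
  qed
  have lim: "(G \<longlongrightarrow> 0 - (1 - 1)) at_top"
    unfolding G_def by (intro tendsto_intros std_normal_cdf_at_top) real_asymp
  have "0 - (1 - 1) \<le> G w"
    by (rule tendsto_upperbound[OF lim eventually_mono[OF eventually_ge_at_top[of w] G]]) simp_all
  then have "exp (w\<^sup>2 / 2) * (1 - std_normal_cdf w) \<le> exp (w\<^sup>2 / 2) * (exp (- w\<^sup>2 / 2) / (1 + w))"
    by (intro mult_left_mono) (auto simp: G_def)
  also have "\<dots> = 1 / (1 + w)"
    by (subst times_divide_eq_right, subst exp_add[symmetric]) simp
  finally show ?thesis .
qed

text \<open>The sum of the values at \<open>v\<close> and \<open>- v\<close> has derivative 0, and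
  its constant value is read off at infinity.\<close>

lemma std_normal_cdf_minus: "std_normal_cdf (- w) = 1 - std_normal_cdf w"
proof -
  define G where "G = (\<lambda>v. std_normal_cdf (- v) + std_normal_cdf v)"
  have "G v = G w" if "w \<le> v" for v
  proof (cases "w = v")
    case False
    with that have "w < v" by simp
    then show ?thesis
    proof (rule DERIV_isconst_end)
      have d: "(G has_real_derivative 0) (at y)" for y
        unfolding G_def by (auto intro!: derivative_eq_intros DERIV_chain2[OF std_normal_cdf_deriv])
      then show "continuous_on {w..v} G" by (meson DERIV_isCont continuous_at_imp_continuous_on)
      show "(G has_real_derivative 0) (at y)" for y by (rule d)
    qed
  qed auto
  then have "(G \<longlongrightarrow> G w) at_top"
    by (rule tendsto_eventually[OF eventually_mono[OF eventually_ge_at_top[of w]]])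
  moreover have "(G \<longlongrightarrow> 0 + 1) at_top"
    unfolding G_def
    by (intro tendsto_intros std_normal_cdf_at_top
          filterlim_compose[OF std_normal_cdf_at_bot filterlim_uminus_at_bot_at_top])
  ultimately have "G w = 0 + 1" by (intro tendsto_unique[of at_top G]) auto
  then show ?thesis by (simp add: G_def)
qed

lemma std_normal_lower_tail:
  assumes "w \<le> 0"
  shows "exp (w\<^sup>2 / 2) * std_normal_cdf w \<le> 1 / (1 - w)"
  using std_normal_upper_tail[of "- w"] assms by (simp add: std_normal_cdf_minus)

section \<open>The bounded solution for a half-line indicator and its regularity\<close>

text \<open>The bounded solution of f'(w) - w f(w) = 1_{w \<le> z} -
  \<open>std_normal_cdf z\<close>; the two branches agree at w = z.\<close>

definition stein_solution :: "real \<Rightarrow> real \<Rightarrow> real" where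
  "stein_solution z w = sqrt (2 * pi) * exp (w\<^sup>2 / 2) *
     (if w \<le> z then std_normal_cdf w * (1 - std_normal_cdf z)
      else std_normal_cdf z * (1 - std_normal_cdf w))"

lemma stein_solution_nonneg: "stein_solution z w \<ge> 0"
  using std_normal_cdf_bounds by (auto simp: stein_solution_def)

text \<open>By monotonicity the product \<open>P\<close> is at most \<open>std_normal_cdf w\<close>
  and at most \<open>1 - std_normal_cdf w\<close>, and the sign of \<open>w\<close> decides which of
  the two has a useful tail bound. The result is uniform in \<open>z\<close>; its decay in
  \<open>w\<close> is what makes w f(w) bounded. The 3 is a bound for sqrt (2 pi).\<close>

lemma stein_solution_le: "stein_solution z w \<le> 3 / (1 + \<bar>w\<bar>)"
proof -
  define E where "E = exp (w\<^sup>2 / 2)"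
  define P where "P = (if w \<le> z then std_normal_cdf w * (1 - std_normal_cdf z)
      else std_normal_cdf z * (1 - std_normal_cdf w))"
  have b: "0 \<le> std_normal_cdf y" "std_normal_cdf y \<le> 1" for y using std_normal_cdf_bounds by auto
  have P0: "0 \<le> P" using b by (auto simp: P_def)
  have m: "std_normal_cdf a \<le> std_normal_cdf c" if "a \<le> c" for a c
    using std_normal_cdf_mono that by (auto simp: mono_def)
  have E: "E > 0" by (simp add: E_def)
  have "P \<le> std_normal_cdf w"
    using b[of w] b[of z] m[of z w] by (auto simp: P_def intro: mult_left_le mult_right_le_one_le
        order.trans[OF mult_left_le])
  moreover have "P \<le> 1 - std_normal_cdf w"
    using b[of w] b[of z] m[of w z] by (auto simp: P_def mult_left_le_one_le intro: order.trans[OF mult_left_le_one_le])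
  ultimately have "E * P \<le> 1 / (1 + \<bar>w\<bar>)"
  proof (cases "w \<ge> 0")
    case True
    have "E * P \<le> E * (1 - std_normal_cdf w)" using E \<open>P \<le> 1 - _\<close> by (intro mult_left_mono) auto
    also have "\<dots> \<le> 1 / (1 + w)" using std_normal_upper_tail[OF True] by (simp add: E_def)
    finally show ?thesis using True by simp
  next
    case False
    have "E * P \<le> E * std_normal_cdf w" using E \<open>P \<le> std_normal_cdf w\<close> by (intro mult_left_mono) auto
    also have "\<dots> \<le> 1 / (1 - w)" using std_normal_lower_tail[of w] False by (simp add: E_def)
    finally show ?thesis using False by simp
  qed
  moreover have "sqrt (2 * pi) \<le> 3"
    using pi_less_4 by (intro real_le_lsqrt) auto
  ultimately have "sqrt (2 * pi) * (E * P) \<le> 3 * (1 / (1 + \<bar>w\<bar>))"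
    using E P0 by (intro mult_mono) auto
  then show ?thesis by (simp add: stein_solution_def E_def P_def mult.assoc)
qed

lemma stein_solution_le_3: "stein_solution z w \<le> 3"
proof -
  have "3 / (1 + \<bar>w\<bar>) \<le> 3 / 1" by (intro divide_left_mono) auto
  then show ?thesis using stein_solution_le[of z w] by simp
qed

lemma abs_mult_stein_solution_le: "\<bar>w * stein_solution z w\<bar> \<le> 3"
proof -
  have "\<bar>w * stein_solution z w\<bar> \<le> \<bar>w\<bar> * (3 / (1 + \<bar>w\<bar>))"
    using stein_solution_le[of z w] stein_solution_nonneg[of z w]
    unfolding abs_mult by (intro mult_left_mono) simp_all
  also have "\<dots> \<le> 3" by (simp add: pos_divide_le_eq)
  finally show ?thesis .
qed

text \<open>Each branch is differentiated as a smooth function on the whole line, with a constant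
  \<open>c\<close> for \<open>std_normal_cdf z\<close>. This allows the mean value theorem on
  intervals that end at the kink.\<close>

lemma stein_solution_deriv:
  defines "E \<equiv> \<lambda>w::real. sqrt (2 * pi) * exp (w\<^sup>2 / 2)"
  shows "((\<lambda>w. E w * (std_normal_cdf w * (1 - c))) has_real_derivative
            w * (E w * (std_normal_cdf w * (1 - c))) + (1 - c)) (at w)"
    and "((\<lambda>w. E w * (c * (1 - std_normal_cdf w))) has_real_derivative
            w * (E w * (c * (1 - std_normal_cdf w))) - c) (at w)"
proof -
  define D where "D = exp (- w\<^sup>2 / 2) / sqrt (2 * pi)"
  define P where "P = std_normal_cdf w"
  define F where "F = E w"
  have "exp (w\<^sup>2 / 2) * exp (- w\<^sup>2 / 2) = 1" by (subst exp_add[symmetric]) simp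
  \<comment> \<open>The integrating factor is the reciprocal of the normal density, so the product
    rule leaves a constant inhomogeneity.\<close>
  then have e: "F * D = 1"
    by (simp add: F_def E_def D_def)
  have d: "(E has_real_derivative w * E w) (at w)" for w
    unfolding E_def by (auto intro!: derivative_eq_intros)
  have "w * F * (P * (1 - c)) + D * (1 - c) * F = w * (F * (P * (1 - c))) + (1 - c)"
    using e by algebra
  then have "w * E w * (std_normal_cdf w * (1 - c)) + exp (- w\<^sup>2 / 2) / sqrt (2 * pi) * (1 - c) * E w
      = w * (E w * (std_normal_cdf w * (1 - c))) + (1 - c)"
    by (simp only: F_def P_def D_def)
  then show "((\<lambda>w. E w * (std_normal_cdf w * (1 - c))) has_real_derivative
            w * (E w * (std_normal_cdf w * (1 - c))) + (1 - c)) (at w)"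
    by (intro DERIV_cong[OF DERIV_mult[OF d DERIV_cmult_right[OF std_normal_cdf_deriv]]])
  have "w * F * (c * (1 - P)) + c * (0 - D) * F = w * (F * (c * (1 - P))) - c"
    using e by algebra
  then have "w * E w * (c * (1 - std_normal_cdf w)) + c * (0 - exp (- w\<^sup>2 / 2) / sqrt (2 * pi)) * E w
      = w * (E w * (c * (1 - std_normal_cdf w))) - c"
    by (simp only: F_def P_def D_def)
  then show "((\<lambda>w. E w * (c * (1 - std_normal_cdf w))) has_real_derivative
            w * (E w * (c * (1 - std_normal_cdf w))) - c) (at w)"
    by (intro DERIV_cong[OF DERIV_mult[OF d DERIV_cmult[OF DERIV_diff[OF DERIV_const std_normal_cdf_deriv]]]])
qed

text \<open>Off the jump of the indicator, a difference of the solution is its derivative, given by Stein's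
  equation, at an intermediate point.\<close>

lemma stein_solution_mvt:
  assumes "a < b" "b \<le> z \<or> z \<le> a"
  obtains y where "a < y" "y < b"
    "stein_solution z b - stein_solution z a =
       (b - a) * (y * stein_solution z y + (if b \<le> z then 1 else 0) - std_normal_cdf z)"
proof (cases "b \<le> z")
  case True
  define f where "f = (\<lambda>w. sqrt (2 * pi) * exp (w\<^sup>2 / 2) * (std_normal_cdf w * (1 - std_normal_cdf z)))"
  have f: "stein_solution z w = f w" if "w \<le> z" for w
    using that by (simp add: stein_solution_def f_def)
  have "\<exists>y. a < y \<and> y < b \<and> f b - f a = (b - a) * (y * f y + (1 - std_normal_cdf z))"
    using stein_solution_deriv(1)[of "std_normal_cdf z"] unfolding f_def
    by (intro MVT2[OF assms(1)]) auto
  then show ?thesis using that f True assms(1) by (smt (verit))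
next
  case False
  define f where "f = (\<lambda>w. sqrt (2 * pi) * exp (w\<^sup>2 / 2) * (std_normal_cdf z * (1 - std_normal_cdf w)))"
  have f: "stein_solution z w = f w" if "z \<le> w" for w
    using that by (cases "w = z") (auto simp: stein_solution_def f_def)
  have "\<exists>y. a < y \<and> y < b \<and> f b - f a = (b - a) * (y * f y - std_normal_cdf z)"
    using stein_solution_deriv(2)[of "std_normal_cdf z"] unfolding f_def
    by (intro MVT2[OF assms(1)]) auto
  then show ?thesis using that f False assms by (smt (verit))
qed

text \<open>4 = 3 + 1: the bound on y f(y), plus the indicator minus
  \<open>std_normal_cdf z\<close>, which lies in [-1, 1].\<close>

lemma stein_solution_lipschitz_aux:
  assumes "a < b" "b \<le> z \<or> z \<le> a"
  shows "\<bar>stein_solution z b - stein_solution z a\<bar> \<le> 4 * (b - a)"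
proof -
  obtain y where y: "stein_solution z b - stein_solution z a =
       (b - a) * (y * stein_solution z y + (if b \<le> z then 1 else 0) - std_normal_cdf z)"
    using stein_solution_mvt[OF assms] by metis
  have "\<bar>y * stein_solution z y + (if b \<le> z then 1 else 0) - std_normal_cdf z\<bar> \<le> 4"
    using abs_mult_stein_solution_le[of y z] std_normal_cdf_bounds[of z] by (cases "b \<le> z") (simp_all add: abs_le_iff)
  from mult_left_mono[OF this, of "b - a"] show ?thesis
    using assms(1) unfolding y abs_mult by simp
qed

lemma stein_solution_lipschitz:
  "\<bar>stein_solution z b - stein_solution z a\<bar> \<le> 4 * \<bar>b - a\<bar>"
proof -
  have *: "\<bar>stein_solution z b - stein_solution z a\<bar> \<le> 4 * (b - a)" if "a < b" for a b
  proof (cases "b \<le> z \<or> z \<le> a")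
    case True
    then show ?thesis using stein_solution_lipschitz_aux that by blast
  next
    case False
    then show ?thesis
      using stein_solution_lipschitz_aux[of a z z] stein_solution_lipschitz_aux[of z b z] by auto
  qed
  show ?thesis using *[of a b] *[of b a] by (cases a b rule: linorder_cases) auto
qed

text \<open>The error of one Euler step for Stein's equation. When the step does not cross
  \<open>z\<close>, only y f(y) changes between \<open>w\<close> and the intermediate point
  \<open>y\<close>, by (y - w) f(y) + w (f(y) - f(w)); the bound 3 and the Lipschitz constant 4
  apply to the two terms.\<close>

lemma stein_solution_step:
  assumes "h > 0" "\<not> (w \<le> z \<and> z < w + h)"
  shows "\<bar>stein_solution z (w + h) - stein_solution z w
     - h * (w * stein_solution z w + (if w \<le> z then 1 else 0) - std_normal_cdf z)\<bar>
     \<le> h\<^sup>2 * (3 + 4 * \<bar>w\<bar>)"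
proof -
  obtain y where y: "w < y" "y < w + h" and eq: "stein_solution z (w + h) - stein_solution z w =
       h * (y * stein_solution z y + (if w + h \<le> z then 1 else 0) - std_normal_cdf z)"
  proof (rule stein_solution_mvt[of w "w + h" z])
    show "w < w + h" "w + h \<le> z \<or> z \<le> w" using assms by auto
  qed simp
  have "(if w + h \<le> z then 1 else 0) = (if w \<le> z then 1 else 0::real)" using assms by auto
  then have "stein_solution z (w + h) - stein_solution z w
     - h * (w * stein_solution z w + (if w \<le> z then 1 else 0) - std_normal_cdf z)
     = h * ((y - w) * stein_solution z y + w * (stein_solution z y - stein_solution z w))"
    unfolding eq by (simp add: algebra_simps)
  also have "\<bar>\<dots>\<bar> \<le> h * (h * 3 + \<bar>w\<bar> * (4 * h))"
  proof -
    have "\<bar>(y - w) * stein_solution z y\<bar> \<le> h * 3"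
      using y stein_solution_nonneg[of z y] stein_solution_le_3[of z y]
      unfolding abs_mult by (intro mult_mono) auto
    moreover have "\<bar>w * (stein_solution z y - stein_solution z w)\<bar> \<le> \<bar>w\<bar> * (4 * h)"
      using y stein_solution_lipschitz[of z y w] unfolding abs_mult by (intro mult_left_mono) auto
    ultimately have "\<bar>(y - w) * stein_solution z y + w * (stein_solution z y - stein_solution z w)\<bar>
        \<le> h * 3 + \<bar>w\<bar> * (4 * h)"
      by linarith
    then show ?thesis using assms(1) unfolding abs_mult[of h] by (intro mult_mono) auto
  qed
  finally show ?thesis by (simp add: power2_eq_square algebra_simps)
qed

section \<open>Stein's method for a lattice distribution\<close>

text \<open>\<open>Q\<close> is the total defect of the discrete analogue of \<phi>'(w) = - w
  \<phi>(w), including the jump from 0 to \<open>p 0\<close>. Multiplying the difference equation by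
  f(W_{j+1}) and summing by parts moves the difference onto f, where Stein's equation turns it into
  the indicator minus \<open>std_normal_cdf z\<close>.\<close>

lemma stein_discrete_bound:
  fixes p :: "nat \<Rightarrow> real" and m s z :: real
  assumes p_nonneg: "\<And>j. p j \<ge> 0" and p_Suc: "p (Suc n) = 0" and p_sum: "(\<Sum>j\<le>n. p j) = 1"
    and s: "s > 0" and var: "(\<Sum>j\<le>n. p j * (real j - m)\<^sup>2) = s\<^sup>2"
  defines "Q \<equiv> p 0 + (\<Sum>j\<le>n. \<bar>p (Suc j) - p j + p j * (real j - m) / s\<^sup>2\<bar>)"
  shows "\<bar>(\<Sum>j\<in>{j. j \<le> n \<and> (real j - m) / s \<le> z}. p j) - std_normal_cdf z\<bar> \<le> (3 * s + 8) * Q + 19 / s"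
proof -
  define h where "h = 1 / s"
  define W where "W = (\<lambda>j. (real j - m) / s)"
  define f where "f = stein_solution z"
  define I where "I = (\<lambda>j. if W j \<le> z then 1 else 0 :: real)"
  define q where "q = (\<lambda>j. p (Suc j) - p j + h * (p j * W j))"
  define d where "d = (\<lambda>j. f (W (Suc j)) - f (W j) - h * (W j * f (W j) + I j - std_normal_cdf z))"
  have h: "h > 0" using s by (simp add: h_def)
  have WS: "W (Suc j) = W j + h" for j using s by (simp add: W_def h_def field_simps)
  have q_eq: "q j = p (Suc j) - p j + p j * (real j - m) / s\<^sup>2" for j
    by (simp add: q_def h_def W_def power2_eq_square)
  have Q: "Q = p 0 + (\<Sum>j\<le>n. \<bar>q j\<bar>)" by (simp add: Q_def q_eq)
  have f3: "\<bar>f w\<bar> \<le> 3" for w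
    using stein_solution_le_3[of z w] stein_solution_nonneg[of z w] by (simp add: f_def)
  have EW2: "(\<Sum>j\<le>n. p j * (W j)\<^sup>2) = 1"
  proof -
    have "(\<Sum>j\<le>n. p j * (W j)\<^sup>2) = (\<Sum>j\<le>n. p j * (real j - m)\<^sup>2) / s\<^sup>2"
      by (simp add: W_def power_divide sum_divide_distrib)
    then show ?thesis using var s by simp
  qed
  have EW: "(\<Sum>j\<le>n. p j * \<bar>W j\<bar>) \<le> 1"
  proof -
    have "2 * \<bar>W j\<bar> \<le> 1 + (W j)\<^sup>2" for j
      using zero_le_power2[of "\<bar>W j\<bar> - 1"] by (simp add: power2_diff)
    then have "(\<Sum>j\<le>n. p j * (2 * \<bar>W j\<bar>)) \<le> (\<Sum>j\<le>n. p j * (1 + (W j)\<^sup>2))"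
      by (intro sum_mono mult_left_mono p_nonneg)
    also have "\<dots> = 2" using p_sum EW2 by (simp add: algebra_simps sum.distrib)
    also have "(\<Sum>j\<le>n. p j * (2 * \<bar>W j\<bar>)) = 2 * (\<Sum>j\<le>n. p j * \<bar>W j\<bar>)"
      by (simp add: sum_distrib_left algebra_simps)
    finally show ?thesis by simp
  qed
  have Q_nonneg: "Q \<ge> 0" using p_nonneg by (auto simp: Q intro!: add_nonneg_nonneg sum_nonneg)

  \<comment> \<open>A single mass is the sum of the increments before it, and an increment is at
    most the defect plus \<open>h\<close> times a summand of the first absolute moment.\<close>
  have pmax: "p k \<le> Q + h" if "k \<le> n" for k
  proof -
    have "p k = p 0 + (\<Sum>j<k. p (Suc j) - p j)" by (simp add: sum_lessThan_telescope)
    also have "\<dots> \<le> p 0 + (\<Sum>j<k. \<bar>q j\<bar> + h * (p j * \<bar>W j\<bar>))"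
    proof (intro add_left_mono sum_mono)
      fix j
      have "\<bar>h * (p j * W j)\<bar> = h * (p j * \<bar>W j\<bar>)"
        using h p_nonneg[of j] by (simp add: abs_mult)
      then show "p (Suc j) - p j \<le> \<bar>q j\<bar> + h * (p j * \<bar>W j\<bar>)"
        unfolding q_def by linarith
    qed
    also have "\<dots> \<le> p 0 + (\<Sum>j\<le>n. \<bar>q j\<bar> + h * (p j * \<bar>W j\<bar>))"
      using that h p_nonneg by (intro add_left_mono sum_mono2) auto
    also have "\<dots> = Q + h * (\<Sum>j\<le>n. p j * \<bar>W j\<bar>)"
      by (simp add: Q sum.distrib sum_distrib_left)
    also have "\<dots> \<le> Q + h * 1" using h EW by (intro add_left_mono mult_left_mono) auto
    finally show ?thesis by simp
  qed

  \<comment> \<open>\<open>f\<close> solves Stein's equation up to \<open>d\<close>, except where a lattice step crosses \<open>z\<close>, which happens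
    at most once.\<close>
  define B where "B = {j. j \<le> n \<and> W j \<le> z \<and> z < W j + h}"
  have B: "(\<Sum>j\<in>B. p j) \<le> Q + h"
  proof -
    have "card B \<le> 1"
    proof -
      have "i = j" if "i \<in> B" "j \<in> B" for i j
      proof -
        have "W i < W j + h" "W j < W i + h" using that by (auto simp: B_def)
        then have "real i - m < real j - m + 1" "real j - m < real i - m + 1"
          using s by (auto simp: W_def h_def divide_simps split: if_splits)
        then show ?thesis by linarith
      qed
      then show ?thesis by (intro card_le_Suc0_iff_eq[THEN iffD2, unfolded One_nat_def[symmetric]]) (auto simp: B_def)
    qed
    have "(\<Sum>j\<in>B. p j) \<le> real (card B) * (Q + h)"
      by (rule sum_bounded_above) (auto simp: B_def intro: pmax)
    also have "\<dots> \<le> 1 * (Q + h)"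
      using \<open>card B \<le> 1\<close> Q_nonneg h by (intro mult_right_mono) auto
    finally show ?thesis by simp
  qed
  \<comment> \<open>A crossing step has no expansion: the Lipschitz bound 4 h and the bound 4 h on
    the Euler increment are added.\<close>
  have d: "\<bar>d j\<bar> \<le> h\<^sup>2 * (3 + 4 * \<bar>W j\<bar>) + (if j \<in> B then 8 * h else 0)" if "j \<le> n" for j
  proof (cases "j \<in> B")
    case False
    then have "\<not> (W j \<le> z \<and> z < W j + h)" using that by (simp add: B_def)
    from stein_solution_step[OF h this] False show ?thesis
      by (simp add: d_def WS f_def I_def)
  next
    case True
    have "\<bar>f (W (Suc j)) - f (W j)\<bar> \<le> 4 * h"
      using stein_solution_lipschitz[of z "W (Suc j)" "W j"] h by (simp add: WS f_def)
    moreover have "\<bar>h * (W j * f (W j) + I j - std_normal_cdf z)\<bar> \<le> h * 4"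
    proof -
      have "\<bar>W j * f (W j) + I j - std_normal_cdf z\<bar> \<le> 4"
        using abs_mult_stein_solution_le[of "W j" z] std_normal_cdf_bounds[of z]
        by (cases "W j \<le> z") (simp_all add: abs_le_iff f_def I_def)
      then show ?thesis using h by (simp add: abs_mult)
    qed
    ultimately have "\<bar>d j\<bar> \<le> 8 * h" unfolding d_def by linarith
    moreover have "0 \<le> h\<^sup>2 * (3 + 4 * \<bar>W j\<bar>)" by simp
    moreover have "(if j \<in> B then 8 * h else 0) = 8 * h" using True by simp
    ultimately show ?thesis by linarith
  qed
  have Ed: "(\<Sum>j\<le>n. p j * \<bar>d j\<bar>) \<le> 7 * h\<^sup>2 + 8 * h * (Q + h)"
  proof -
    have "(\<Sum>j\<le>n. p j * \<bar>d j\<bar>) \<le> (\<Sum>j\<le>n. p j * (h\<^sup>2 * (3 + 4 * \<bar>W j\<bar>) + (if j \<in> B then 8 * h else 0)))"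
      by (intro sum_mono mult_left_mono p_nonneg d) auto
    also have "\<dots> = 3 * h\<^sup>2 * (\<Sum>j\<le>n. p j) + 4 * h\<^sup>2 * (\<Sum>j\<le>n. p j * \<bar>W j\<bar>)
        + (\<Sum>j\<le>n. if j \<in> B then 8 * h * p j else 0)"
      unfolding sum_distrib_left sum.distrib[symmetric] by (intro sum.cong) (auto simp: algebra_simps)
    also have "(\<Sum>j\<le>n. if j \<in> B then 8 * h * p j else 0) = 8 * h * (\<Sum>j\<in>B. p j)"
    proof -
      have "{..n} \<inter> {j. j \<in> B} = B" by (auto simp: B_def)
      then show ?thesis by (simp add: sum.If_cases sum_distrib_left)
    qed
    also have "3 * h\<^sup>2 * (\<Sum>j\<le>n. p j) + 4 * h\<^sup>2 * (\<Sum>j\<le>n. p j * \<bar>W j\<bar>) + 8 * h * (\<Sum>j\<in>B. p j)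
        \<le> 3 * h\<^sup>2 * 1 + 4 * h\<^sup>2 * 1 + 8 * h * (Q + h)"
      using p_sum EW B h by (intro add_mono mult_left_mono) auto
    finally show ?thesis by simp
  qed

  have parts: "(\<Sum>j\<le>n. p (Suc j) * f (W (Suc j))) = (\<Sum>j\<le>n. p j * f (W j)) - p 0 * f (W 0)"
    using sum.atMost_Suc_shift[of "\<lambda>j. p j * f (W j)" n] p_Suc by simp
  \<comment> \<open>The increments of p f telescope to \<open>- p 0 * f (W 0)\<close>, since
    \<open>p\<close> vanishes at n + 1. Written out with \<open>q\<close> and \<open>d\<close>, they
    contain the wanted sum with factor \<open>h\<close>; the product \<open>p j * W j\<close> meets
    f at W_{j+1} instead of W_j, whence the third term.\<close>
  have id: "h * (\<Sum>j\<le>n. p j * (I j - std_normal_cdf z)) =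
      - p 0 * f (W 0) - (\<Sum>j\<le>n. q j * f (W (Suc j)))
      + h * (\<Sum>j\<le>n. p j * W j * (f (W (Suc j)) - f (W j))) - (\<Sum>j\<le>n. p j * d j)"
  proof -
    have "h * (\<Sum>j\<le>n. p j * (I j - std_normal_cdf z)) + (\<Sum>j\<le>n. q j * f (W (Suc j)))
      - h * (\<Sum>j\<le>n. p j * W j * (f (W (Suc j)) - f (W j))) + (\<Sum>j\<le>n. p j * d j)
      = (\<Sum>j\<le>n. p (Suc j) * f (W (Suc j)) - p j * f (W j))"
      unfolding sum_distrib_left sum.distrib[symmetric] sum_subtractf[symmetric]
      by (intro sum.cong) (auto simp: q_def d_def algebra_simps)
    also have "\<dots> = - p 0 * f (W 0)" using parts by (simp add: sum_subtractf)
    finally show ?thesis by linarith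
  qed
  have b1: "\<bar>p 0 * f (W 0)\<bar> + \<bar>\<Sum>j\<le>n. q j * f (W (Suc j))\<bar> \<le> 3 * Q"
  proof -
    have "\<bar>\<Sum>j\<le>n. q j * f (W (Suc j))\<bar> \<le> (\<Sum>j\<le>n. \<bar>q j\<bar> * 3)"
      using f3 by (intro order.trans[OF sum_abs] sum_mono) (auto simp: abs_mult intro: mult_left_mono)
    moreover have "\<bar>p 0 * f (W 0)\<bar> \<le> p 0 * 3"
      using f3 p_nonneg by (auto simp: abs_mult intro: mult_left_mono)
    ultimately show ?thesis by (simp add: Q sum_distrib_left[symmetric] sum_distrib_right[symmetric])
  qed
  have b2: "\<bar>\<Sum>j\<le>n. p j * W j * (f (W (Suc j)) - f (W j))\<bar> \<le> 4 * h"
  proof -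
    have "\<bar>\<Sum>j\<le>n. p j * W j * (f (W (Suc j)) - f (W j))\<bar> \<le> (\<Sum>j\<le>n. p j * \<bar>W j\<bar> * (4 * h))"
    proof (intro order.trans[OF sum_abs] sum_mono)
      fix j
      have "\<bar>f (W (Suc j)) - f (W j)\<bar> \<le> 4 * h"
        using stein_solution_lipschitz[of z "W (Suc j)" "W j"] h by (simp add: WS f_def)
      then show "\<bar>p j * W j * (f (W (Suc j)) - f (W j))\<bar> \<le> p j * \<bar>W j\<bar> * (4 * h)"
        using p_nonneg[of j] unfolding abs_mult by (intro mult_mono) auto
    qed
    also have "\<dots> = (\<Sum>j\<le>n. p j * \<bar>W j\<bar>) * (4 * h)" by (simp add: sum_distrib_right)
    also have "\<dots> \<le> 1 * (4 * h)" using EW h by (intro mult_right_mono) auto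
    finally show ?thesis by simp
  qed
  have b3: "\<bar>\<Sum>j\<le>n. p j * d j\<bar> \<le> 7 * h\<^sup>2 + 8 * h * (Q + h)"
    using p_nonneg by (intro order.trans[OF sum_abs order.trans[OF _ Ed]]) (simp add: abs_mult)
  have "h * \<bar>\<Sum>j\<le>n. p j * (I j - std_normal_cdf z)\<bar> = \<bar>h * (\<Sum>j\<le>n. p j * (I j - std_normal_cdf z))\<bar>"
    using h by (simp add: abs_mult)
  also have "\<dots> \<le> 3 * Q + h * (4 * h) + (7 * h\<^sup>2 + 8 * h * (Q + h))"
  proof -
    have "\<bar>h * (\<Sum>j\<le>n. p j * W j * (f (W (Suc j)) - f (W j)))\<bar> \<le> h * (4 * h)"
      using b2 h by (simp add: abs_mult)
    then show ?thesis using b1 b3 unfolding id by linarith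
  qed
  \<comment> \<open>Taking out \<open>h\<close> turns 3 Q into 3 s Q, and 19 = 4 + 7 + 8 collects
    the multiples of h^2.\<close>
  also have "\<dots> = h * ((3 * s + 8) * Q + 19 / s)"
    using s by (simp add: h_def field_simps power2_eq_square)
  finally have "\<bar>\<Sum>j\<le>n. p j * (I j - std_normal_cdf z)\<bar> \<le> (3 * s + 8) * Q + 19 / s"
    using h by simp
  also have "(\<Sum>j\<le>n. p j * (I j - std_normal_cdf z)) = (\<Sum>j\<le>n. p j * I j) - std_normal_cdf z"
    using p_sum by (simp add: right_diff_distrib sum_subtractf sum_distrib_right[symmetric])
  also have "(\<Sum>j\<le>n. p j * I j) = (\<Sum>j\<in>{j. j \<le> n \<and> (real j - m) / s \<le> z}. p j)"
    by (intro sum.mono_neutral_cong_right) (auto simp: I_def W_def)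
  finally show ?thesis .
qed

section \<open>Ratios of weights and the fourth moment\<close>

text \<open>By the mean value theorem the increment of ln Gamma over [y, y + a] is \<open>a\<close>
  times a value of Digamma. Digamma is increasing, so this value lies between those from the unit
  intervals [y - 1, y] and [y + a, y + a + 1], on which the functional equation gives the increments
  ln (y - 1) and ln (y + a).\<close>

lemma Gamma_ratio_bounds:
  fixes a y :: real
  assumes a: "a > 0" and y: "y > 0"
  shows "Gamma (y + a) / Gamma y \<le> (y + a) powr a"
    and "y \<ge> 1 \<Longrightarrow> (y - 1) powr a \<le> Gamma (y + a) / Gamma y"
proof -
  have mvt: "\<exists>u. b < u \<and> u < c \<and> ln_Gamma c - ln_Gamma b = (c - b) * Digamma u"
    if "0 < b" "b < c" for b c :: real
    using that by (intro MVT2) (auto intro!: derivative_eq_intros)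
  have step: "ln_Gamma (b + 1) - ln_Gamma b = ln b" if "b > 0" for b :: real
  proof -
    have "Gamma (b + 1) = b * Gamma b" using that by (intro Gamma_plus1) (auto simp: nonpos_Ints_def)
    moreover have "ln (b * Gamma b) = ln b + ln (Gamma b)"
      using Gamma_real_pos[OF that] that by (intro ln_mult_pos)
    ultimately show ?thesis using that by (simp add: ln_Gamma_real_pos)
  qed
  obtain u where u: "y < u" "u < y + a" "ln_Gamma (y + a) - ln_Gamma y = a * Digamma u"
    using mvt[of y "y + a"] assms by auto
  have eq: "Gamma (y + a) / Gamma y = exp (a * Digamma u)"
    using assms unfolding u(3)[symmetric] by (simp add: exp_diff Gamma_real_pos_exp)
  obtain v where v: "y + a < v" "ln (y + a) = Digamma v"
    using mvt[of "y + a" "y + a + 1"] step[of "y + a"] assms by auto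
  have "Digamma u < Digamma v"
    using u v y by (intro Digamma_real_strict_mono) auto
  then have "a * Digamma u \<le> a * ln (y + a)" using v a by simp
  then show "Gamma (y + a) / Gamma y \<le> (y + a) powr a"
    unfolding eq using assms by (simp add: powr_def)
  show "(y - 1) powr a \<le> Gamma (y + a) / Gamma y" if "y \<ge> 1"
  \<comment> \<open>For y = 1 the left side is \<open>0 powr a\<close>, which is 0; the unit
    interval to the left of \<open>y\<close> needs y > 1.\<close>
  proof (cases "y = 1")
    case False
    with that have "y > 1" by simp
    then obtain v where v: "y - 1 < v" "v < y" "ln (y - 1) = Digamma v"
      using mvt[of "y - 1" y] step[of "y - 1"] by auto
    have "Digamma v < Digamma u"
      using u v \<open>y > 1\<close> by (intro Digamma_real_strict_mono) auto
    then have "a * ln (y - 1) \<le> a * Digamma u" using v a by simp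
    then show ?thesis unfolding eq using \<open>y > 1\<close> by (simp add: powr_def)
  qed (use eq in simp)
qed

lemma frac_binomial_weight_Suc:
  assumes \<alpha>: "\<alpha> > 0" and x: "0 < x" "x < 1" and j: "j < n"
  defines "G \<equiv> \<lambda>y. Gamma (y + \<alpha>) / Gamma y"
  shows "frac_binomial_weight \<alpha> x n (Suc j) =
    frac_binomial_weight \<alpha> x n j * (G (\<alpha> * (real n - real j - 1) + 1) / G (\<alpha> * real j + 1) * (x / (1 - x)) powr \<alpha>)"
proof -
  have pos: "\<alpha> * (real n - real j - 1) + 1 > 0" "\<alpha> * real j + 1 > 0"
    using \<alpha> j by (auto intro!: add_nonneg_pos mult_nonneg_nonneg)
  then have pos': "Gamma (\<alpha> * (real n - real j - 1) + 1) > 0" "Gamma (\<alpha> * real j + 1) > 0"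
    "Gamma (\<alpha> * (real n - real j - 1) + 1 + \<alpha>) > 0" "Gamma (\<alpha> * real j + 1 + \<alpha>) > 0"
    using \<alpha> by (auto intro!: Gamma_real_pos)
  have arg: "\<alpha> * real n - \<alpha> * real j + 1 = \<alpha> * (real n - real j - 1) + 1 + \<alpha>"
    "\<alpha> * real n - \<alpha> * real (Suc j) + 1 = \<alpha> * (real n - real j - 1) + 1"
    "\<alpha> * real (Suc j) + 1 = \<alpha> * real j + 1 + \<alpha>"
    by (simp_all add: algebra_simps)
  have rp: "rpow x a = x powr a" "rpow (1 - x) a = (1 - x) powr a" for a
    using x by (simp_all add: rpow_def)
  have pw: "x powr (\<alpha> * real (Suc j)) = x powr (\<alpha> * real j) * x powr \<alpha>"
    "(1 - x) powr (\<alpha> * (real n - real j)) = (1 - x) powr (\<alpha> * (real n - real (Suc j))) * (1 - x) powr \<alpha>"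
    by (simp_all add: algebra_simps flip: powr_add)
  have dv: "(x / (1 - x)) powr \<alpha> = x powr \<alpha> / (1 - x) powr \<alpha>" "(1 - x) powr \<alpha> > 0"
    using x by (simp_all add: powr_divide)
  show ?thesis
    unfolding frac_binomial_weight_def real_binomial_def G_def arg rp pw dv(1)
    using pos' dv(2) by (simp add: divide_simps)
qed

lemma frac_binomial_weight_pos:
  assumes "\<alpha> > 0" "0 < x" "x < 1" "j \<le> n"
  shows "frac_binomial_weight \<alpha> x n j > 0"
proof -
  have "\<alpha> * real n + 1 > 0" "\<alpha> * real j + 1 > 0" "\<alpha> * real n - \<alpha> * real j + 1 > 0"
    using assms by (auto intro!: add_nonneg_pos simp flip: right_diff_distrib)
  then show ?thesis
    using assms by (auto simp: frac_binomial_weight_def real_binomial_def rpow_def Gamma_real_pos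
        intro!: mult_pos_pos divide_pos_pos)
qed

text \<open>At \<alpha> i + 1 the Gamma ratio lies between the \<alpha>-th powers of \<alpha> i and
  \<alpha> (i + 1 + 1/\<alpha>). The factors \<alpha> cancel, and the ratio of ordinary binomial
  weights remains, with bounded shifts and raised to the power \<alpha>. The upper bound excludes j
  = 0, where its denominator vanishes.\<close>

lemma frac_binomial_weight_Suc_bounds:
  assumes \<alpha>: "\<alpha> > 0" and x: "0 < x" "x < 1" and j: "j < n"
  shows "0 < j \<Longrightarrow> frac_binomial_weight \<alpha> x n (Suc j) \<le> frac_binomial_weight \<alpha> x n j *
      ((real n - real j + 1 / \<alpha>) * x / (real j * (1 - x))) powr \<alpha>"
    and "frac_binomial_weight \<alpha> x n j *
      ((real n - real j - 1) * x / ((real j + 1 + 1 / \<alpha>) * (1 - x))) powr \<alpha>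
      \<le> frac_binomial_weight \<alpha> x n (Suc j)"
proof -
  define G where "G = (\<lambda>y. Gamma (y + \<alpha>) / Gamma y)"
  define k where "k = real n - real j - 1"
  have k: "k \<ge> 0" using j by (simp add: k_def)
  define w where "w = frac_binomial_weight \<alpha> x n j"
  have w: "w > 0" unfolding w_def using assms by (intro frac_binomial_weight_pos) auto
  have eq: "frac_binomial_weight \<alpha> x n (Suc j) = w * (G (\<alpha> * k + 1) / G (\<alpha> * real j + 1) * (x / (1 - x)) powr \<alpha>)"
    unfolding w_def G_def k_def by (rule frac_binomial_weight_Suc[OF assms])
  have pos: "\<alpha> * k + 1 > 0" "\<alpha> * real j + 1 > 0"
    using \<alpha> k by (auto intro!: add_nonneg_pos)
  have ub: "G (\<alpha> * i + 1) \<le> (\<alpha> * (i + 1 + 1 / \<alpha>)) powr \<alpha>" if "i \<ge> 0" for i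
  proof -
    have "\<alpha> * i + 1 > 0" using that \<alpha> by (intro add_nonneg_pos) auto
    then show ?thesis
      using Gamma_ratio_bounds(1)[OF \<alpha>, of "\<alpha> * i + 1"] \<alpha>
      by (simp add: G_def algebra_simps)
  qed
  have lb: "(\<alpha> * i) powr \<alpha> \<le> G (\<alpha> * i + 1)" if "i \<ge> 0" for i
    using Gamma_ratio_bounds(2)[OF \<alpha>, of "\<alpha> * i + 1"] that \<alpha>
    by (simp add: G_def add_nonneg_pos)
  have Gpos: "G (\<alpha> * i + 1) > 0" if "i \<ge> 0" for i
    using \<alpha> that by (auto simp: G_def intro!: divide_pos_pos Gamma_real_pos add_nonneg_pos mult_nonneg_nonneg)
  have R: "(x / (1 - x)) powr \<alpha> \<ge> 0" by simp
  show "frac_binomial_weight \<alpha> x n (Suc j) \<le> frac_binomial_weight \<alpha> x n j *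
      ((real n - real j + 1 / \<alpha>) * x / (real j * (1 - x))) powr \<alpha>" if "0 < j"
  proof -
    have "G (\<alpha> * k + 1) / G (\<alpha> * real j + 1) * (x / (1 - x)) powr \<alpha>
      \<le> (\<alpha> * (k + 1 + 1 / \<alpha>)) powr \<alpha> / (\<alpha> * real j) powr \<alpha> * (x / (1 - x)) powr \<alpha>"
      using ub[OF k] lb[of "real j"] Gpos[OF k] that \<alpha>
      by (intro mult_right_mono frac_le) auto
    also have "\<dots> = ((\<alpha> * (k + 1 + 1 / \<alpha>)) / (\<alpha> * real j) * (x / (1 - x))) powr \<alpha>"
      using \<alpha> k x that by (simp add: powr_mult powr_divide)
    also have "(\<alpha> * (k + 1 + 1 / \<alpha>)) / (\<alpha> * real j) * (x / (1 - x)) =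
        (real n - real j + 1 / \<alpha>) * x / (real j * (1 - x))"
      using \<alpha> by (simp add: k_def)
    finally show ?thesis unfolding eq w_def[symmetric] using w by (intro mult_left_mono) auto
  qed
  show "frac_binomial_weight \<alpha> x n j *
      ((real n - real j - 1) * x / ((real j + 1 + 1 / \<alpha>) * (1 - x))) powr \<alpha>
      \<le> frac_binomial_weight \<alpha> x n (Suc j)"
  proof -
    have "(real n - real j - 1) * x / ((real j + 1 + 1 / \<alpha>) * (1 - x)) =
        (\<alpha> * k) / (\<alpha> * (real j + 1 + 1 / \<alpha>)) * (x / (1 - x))"
      using \<alpha> by (simp add: k_def)
    also have "\<dots> powr \<alpha> = (\<alpha> * k) powr \<alpha> / (\<alpha> * (real j + 1 + 1 / \<alpha>)) powr \<alpha> * (x / (1 - x)) powr \<alpha>"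
      using \<alpha> k x by (simp add: powr_mult powr_divide)
    also have "\<dots> \<le> G (\<alpha> * k + 1) / G (\<alpha> * real j + 1) * (x / (1 - x)) powr \<alpha>"
      using lb[OF k] ub[of "real j"] Gpos[of "real j"] Gpos[OF k] \<alpha>
      by (intro mult_right_mono frac_le) auto
    finally show ?thesis unfolding eq w_def[symmetric] using w by (intro mult_left_mono) auto
  qed
qed

lemma frac_binomial_weight_reflect:
  assumes "j \<le> n"
  shows "frac_binomial_weight \<alpha> x n (n - j) = frac_binomial_weight \<alpha> (1 - x) n j"
  using assms by (simp add: frac_binomial_weight_def real_binomial_def of_nat_diff algebra_simps)

lemma frac_binomial_Z_reflect: "frac_binomial_Z \<alpha> x n = frac_binomial_Z \<alpha> (1 - x) n"
proof -
  have "(\<Sum>j=0..n. frac_binomial_weight \<alpha> x n j) = (\<Sum>j=0..n. frac_binomial_weight \<alpha> x n (n - j))"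
    by (rule sum.reindex_bij_witness[of _ "\<lambda>j. n - j" "\<lambda>j. n - j"]) auto
  then show ?thesis by (simp add: frac_binomial_Z_def frac_binomial_weight_reflect)
qed

context
  fixes \<alpha> x :: real
  assumes \<alpha>: "\<alpha> > 0" and x: "0 < x" "x < 1"
begin

abbreviation (input) "fbp n \<equiv> pmf (frac_binomial_pmf \<alpha> x n)"

lemma frac_binomial_pmf_eq:
  "fbp n j = (if j \<le> n then \<alpha> / frac_binomial_Z \<alpha> x n * frac_binomial_weight \<alpha> x n j else 0)"
  using pmf_frac_binomial_pmf \<alpha> x by simp

lemma sum_frac_binomial_pmf: "(\<Sum>j\<le>n. fbp n j) = 1"
  by (rule sum_pmf_eq_1) (auto simp: set_pmf_eq frac_binomial_pmf_eq split: if_splits)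

lemma frac_binomial_pmf_Suc_bounds:
  assumes "j < n"
  shows "0 < j \<Longrightarrow> fbp n (Suc j) \<le> fbp n j *
      ((real n - real j + 1 / \<alpha>) * x / (real j * (1 - x))) powr \<alpha>"
    and "fbp n j * ((real n - real j - 1) * x / ((real j + 1 + 1 / \<alpha>) * (1 - x))) powr \<alpha>
      \<le> fbp n (Suc j)"
proof -
  have c: "\<alpha> / frac_binomial_Z \<alpha> x n \<ge> 0"
    using frac_binomial_Z_pos[of \<alpha> x n] \<alpha> x by simp
  note b = frac_binomial_weight_Suc_bounds[OF \<alpha> x assms]
  show "0 < j \<Longrightarrow> fbp n (Suc j) \<le> fbp n j *
      ((real n - real j + 1 / \<alpha>) * x / (real j * (1 - x))) powr \<alpha>"
    using mult_left_mono[OF b(1) c] assms by (simp add: frac_binomial_pmf_eq mult.assoc)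
  show "fbp n j * ((real n - real j - 1) * x / ((real j + 1 + 1 / \<alpha>) * (1 - x))) powr \<alpha>
      \<le> fbp n (Suc j)"
    using mult_left_mono[OF b(2) c] assms by (simp add: frac_binomial_pmf_eq mult.assoc)
qed

section \<open>Decay of the masses away from the centre, and the fourth moment\<close>

text \<open>The shift x / \<alpha> of the centre is chosen so that the base of the upper ratio bound
  is exactly 1 - v / (j (1 - x)), which for j < n is at most exp (- v / n). Hence p_{j+1} \<le> p_j
  / (1 + \<alpha> v / n), and v \<le> n makes the decrease linear in \<open>v\<close>. For j = n the
  next mass is 0.\<close>

lemma frac_binomial_pmf_drift:
  assumes "j \<le> n" and v: "v > 0" and jv: "real j = real n * x + x / \<alpha> + v"
  shows "\<alpha> / (1 + \<alpha>) * v * fbp n j \<le> real n * (fbp n j - fbp n (Suc j))"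
proof (cases "j = n")
  case True
  have "0 \<le> real n * x + x / \<alpha>" using \<alpha> x by simp
  then have "v \<le> real n" using jv True by simp
  moreover have "\<alpha> / (1 + \<alpha>) \<le> 1" using \<alpha> by simp
  ultimately have "\<alpha> / (1 + \<alpha>) * v \<le> 1 * real n" using v \<alpha> by (intro mult_mono) auto
  then have "\<alpha> / (1 + \<alpha>) * v * fbp n j \<le> 1 * real n * fbp n j" by (intro mult_right_mono) auto
  moreover have "fbp n (Suc j) = 0" using True by (simp add: frac_binomial_pmf_eq)
  ultimately show ?thesis by simp
next
  case False
  then have jn: "j < n" using assms by simp
  then have n: "real n > 0" by simp
  have j0: "real j > 0" using v n x \<alpha> unfolding jv by (intro add_nonneg_pos) auto
  have "v \<le> real j" using x \<alpha> unfolding jv by simp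
  then have vn: "v \<le> real n" using jn by simp
  have "(real n - real j + 1 / \<alpha>) * x / (real j * (1 - x)) = 1 - v / (real j * (1 - x))"
  proof -
    have "real j * (1 - x) - v = (real n - real j + 1 / \<alpha>) * x"
      unfolding jv using \<alpha> by (simp add: field_simps)
    moreover have "1 - v / (real j * (1 - x)) = (real j * (1 - x) - v) / (real j * (1 - x))"
      using j0 x by (simp add: diff_divide_distrib)
    ultimately show ?thesis by simp
  qed
  moreover have "v / n \<le> v / (real j * (1 - x))"
  proof (rule divide_left_mono)
    have "real j * (1 - x) \<le> real n * 1" using jn x by (intro mult_mono) auto
    then show "real j * (1 - x) \<le> real n" by simp
  qed (use v j0 x n in auto)
  ultimately have B: "(real n - real j + 1 / \<alpha>) * x / (real j * (1 - x)) \<le> exp (- (v / n))"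
    using exp_ge_add_one_self[of "- (v / n)"] by linarith
  define y where "y = v / n"
  have y: "0 \<le> y" "y \<le> 1" using v vn n by (auto simp: y_def)
  have ay: "1 + \<alpha> * y > 0" using y \<alpha> by (intro add_pos_nonneg) auto
  have "0 \<le> (real n - real j + 1 / \<alpha>) * x / (real j * (1 - x))"
    using jn x \<alpha> by (intro divide_nonneg_nonneg mult_nonneg_nonneg add_nonneg_nonneg) auto
  then have "((real n - real j + 1 / \<alpha>) * x / (real j * (1 - x))) powr \<alpha> \<le> exp (- y) powr \<alpha>"
    using B \<alpha> unfolding y_def by (intro powr_mono2) auto
  also have "\<dots> = inverse (exp (\<alpha> * y))"
    unfolding exp_minus[symmetric] powr_def by simp
  also have "\<dots> \<le> inverse (1 + \<alpha> * y)"
    using ay by (intro le_imp_inverse_le exp_ge_add_one_self)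
  finally have "fbp n j * ((real n - real j + 1 / \<alpha>) * x / (real j * (1 - x))) powr \<alpha>
      \<le> fbp n j * inverse (1 + \<alpha> * y)" by (intro mult_left_mono) auto
  moreover have "fbp n (Suc j) \<le> fbp n j *
      ((real n - real j + 1 / \<alpha>) * x / (real j * (1 - x))) powr \<alpha>"
    using frac_binomial_pmf_Suc_bounds(1)[OF jn] j0 by simp
  ultimately have le: "fbp n (Suc j) \<le> fbp n j / (1 + \<alpha> * y)" by (simp add: divide_inverse)
  have "fbp n j * (\<alpha> * y) / (1 + \<alpha>) \<le> fbp n j * (\<alpha> * y) / (1 + \<alpha> * y)"
    using y \<alpha> ay by (intro divide_left_mono) (auto intro: mult_left_le)
  also have "\<dots> = fbp n j - fbp n j / (1 + \<alpha> * y)"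
    using ay by (simp add: field_simps)
  also have "\<dots> \<le> fbp n j - fbp n (Suc j)" using le by simp
  finally have "n * (fbp n j * (\<alpha> * y) / (1 + \<alpha>)) \<le> n * (fbp n j - fbp n (Suc j))"
    using n by (intro mult_left_mono) auto
  then show ?thesis using n by (simp add: y_def mult_ac)
qed

end

text \<open>Testing the drift against v^k and summing by parts bounds the truncated moment of order
  k + 1 by one of order k - 1; k = 1 and then k = 3 are used. Only the tail to the right of
  \<open>b\<close> is seen.\<close>

lemma drift_fourth_moment:
  fixes p :: "nat \<Rightarrow> real"
  assumes p_nonneg: "\<And>j. p j \<ge> 0" and p_Suc: "p (Suc n) = 0" and b: "b \<ge> 0" and c: "c > 0"
    and drift: "\<And>j. j \<le> n \<Longrightarrow> real j > b \<Longrightarrow> c * (real j - b) * p j \<le> r * (p j - p (Suc j))"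
    and r: "r \<ge> 0"
  defines "v \<equiv> \<lambda>j. max 0 (real j - b)"
  shows "(\<Sum>j\<le>n. p j * v j ^ 4) \<le> 3 * (r / c)\<^sup>2 * (\<Sum>j\<le>n. p j)"
proof -
  define v' where "v' = (\<lambda>j. max 0 (real j - 1 - b))"
  \<comment> \<open>\<open>v'\<close> is \<open>v\<close> one step to the left. With k > 0 the terms
    with v = 0, where no drift is assumed, vanish, and so does the boundary term at 0 because b
    \<ge> 0.\<close>
  have parts: "c * (\<Sum>j\<le>n. p j * v j ^ Suc k) \<le> r * (\<Sum>j\<le>n. p j * (v j ^ k - v' j ^ k))" if k: "k > 0" for k
  proof -
    have "c * (\<Sum>j\<le>n. p j * v j ^ Suc k) \<le> (\<Sum>j\<le>n. r * (p j - p (Suc j)) * v j ^ k)"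
      unfolding sum_distrib_left
    proof (intro sum_mono)
      fix j assume "j \<in> {..n}"
      then show "c * (p j * v j ^ Suc k) \<le> r * (p j - p (Suc j)) * v j ^ k"
        using mult_right_mono[OF drift[of j], of "v j ^ k"] k
        by (cases "real j > b") (auto simp: v_def mult_ac zero_power)
    qed
    also have "\<dots> = r * ((\<Sum>j\<le>n. p j * v j ^ k) - (\<Sum>j\<le>n. p (Suc j) * v' (Suc j) ^ k))"
      unfolding right_diff_distrib[of r] sum_distrib_left sum_subtractf[symmetric]
      by (intro sum.cong) (auto simp: v_def v'_def algebra_simps)
    also have "(\<Sum>j\<le>n. p (Suc j) * v' (Suc j) ^ k) = (\<Sum>j\<le>n. p j * v' j ^ k)"
      using sum.atMost_Suc_shift[of "\<lambda>j. p j * v' j ^ k" n] p_Suc b k by (simp add: v'_def)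
    also have "(\<Sum>j\<le>n. p j * v j ^ k) - (\<Sum>j\<le>n. p j * v' j ^ k) = (\<Sum>j\<le>n. p j * (v j ^ k - v' j ^ k))"
      by (simp add: right_diff_distrib sum_subtractf)
    finally show ?thesis .
  qed
  have v: "0 \<le> v' j" "v' j \<le> v j" "v j - v' j \<le> 1" for j by (auto simp: v_def v'_def)
  have "c * (\<Sum>j\<le>n. p j * (v j)\<^sup>2) \<le> r * (\<Sum>j\<le>n. p j * (v j - v' j))"
    using parts[of 1] by (simp add: numeral_2_eq_2)
  also have "\<dots> \<le> r * (\<Sum>j\<le>n. p j * 1)"
    using v r p_nonneg by (intro mult_left_mono sum_mono) auto
  finally have 2: "(\<Sum>j\<le>n. p j * (v j)\<^sup>2) \<le> r / c * (\<Sum>j\<le>n. p j)"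
    using c by (simp add: field_simps)
  have "c * (\<Sum>j\<le>n. p j * v j ^ 4) \<le> r * (\<Sum>j\<le>n. p j * (v j ^ 3 - v' j ^ 3))"
    using parts[of 3] by (simp add: eval_nat_numeral)
  also have "\<dots> \<le> r * (\<Sum>j\<le>n. p j * (3 * (v j)\<^sup>2))"
  proof (intro mult_left_mono sum_mono p_nonneg r)
    fix j
    have "v j ^ 3 - v' j ^ 3 = (v j - v' j) * ((v j)\<^sup>2 + v j * v' j + (v' j)\<^sup>2)"
      by (simp add: algebra_simps power2_eq_square power3_eq_cube)
    also have "\<dots> \<le> 1 * ((v j)\<^sup>2 + v j * v j + (v j)\<^sup>2)"
      using v[of j] by (intro mult_mono add_mono power_mono) auto
    finally show "v j ^ 3 - v' j ^ 3 \<le> 3 * (v j)\<^sup>2" by (simp add: power2_eq_square)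
  qed
  also have "\<dots> = 3 * r * (\<Sum>j\<le>n. p j * (v j)\<^sup>2)" by (simp add: sum_distrib_left mult_ac)
  also have "\<dots> \<le> 3 * r * (r / c * (\<Sum>j\<le>n. p j))" using 2 r by (intro mult_left_mono) auto
  finally show ?thesis using c by (simp add: field_simps power2_eq_square)
qed

text \<open>The left tail is the right tail of the law for 1 - x under j -> n - j. The drift centre
  and its mirror image are within 1 / \<alpha> of n x, whence the summand
  \<open>1 / \<alpha> ^ 4\<close>, absorbed into n^2 as n \<ge> 1. The 8 is the constant in (a +
  b)^4 \<le> 8 (a^4 + b^4).\<close>

lemma frac_binomial_pmf_fourth_moment:
  fixes \<alpha> x :: real
  assumes \<alpha>: "\<alpha> > 0" and x: "0 < x" "x < 1" and n: "n \<ge> 1"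
  shows "(\<Sum>j\<le>n. pmf (frac_binomial_pmf \<alpha> x n) j * (real j - real n * x) ^ 4)
    \<le> 8 * (6 * ((1 + \<alpha>) / \<alpha>)\<^sup>2 + 1 / \<alpha> ^ 4) * (real n)\<^sup>2"
proof -
  define p where "p = (\<lambda>x. pmf (frac_binomial_pmf \<alpha> x n))"
  define v where "v = (\<lambda>x j. max 0 (real j - (real n * x + x / \<alpha>)))"
  define D where "D = (1 + \<alpha>) / \<alpha>"
  have m4: "(\<Sum>j\<le>n. p x j * v x j ^ 4) \<le> 3 * (real n * D)\<^sup>2" if "0 < x" "x < 1" for x
  proof -
    have "(\<Sum>j\<le>n. p x j * v x j ^ 4) \<le> 3 * (real n / (\<alpha> / (1 + \<alpha>)))\<^sup>2 * (\<Sum>j\<le>n. p x j)"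
      unfolding v_def p_def
    proof (rule drift_fourth_moment)
      fix j assume "j \<le> n" "real j > real n * x + x / \<alpha>"
      then show "\<alpha> / (1 + \<alpha>) * (real j - (real n * x + x / \<alpha>)) * pmf (frac_binomial_pmf \<alpha> x n) j
        \<le> real n * (pmf (frac_binomial_pmf \<alpha> x n) j - pmf (frac_binomial_pmf \<alpha> x n) (Suc j))"
        by (intro frac_binomial_pmf_drift[OF \<alpha> that]) auto
    qed (use \<alpha> that in \<open>simp_all add: frac_binomial_pmf_eq[of \<alpha> x n "Suc n"]\<close>)
    then show ?thesis using sum_frac_binomial_pmf[OF \<alpha> that] by (simp add: p_def D_def)
  qed
  have refl: "(\<Sum>j\<le>n. p x j * v (1 - x) (n - j) ^ 4) = (\<Sum>j\<le>n. p (1 - x) j * v (1 - x) j ^ 4)"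
  proof (rule sum.reindex_bij_witness[of _ "\<lambda>j. n - j" "\<lambda>j. n - j"])
    fix j assume "j \<in> {..n}"
    then have "p (1 - x) (n - j) = p x j"
      using \<alpha> x frac_binomial_weight_reflect[of j n \<alpha> "1 - x"] frac_binomial_Z_reflect[of \<alpha> x n]
      by (simp add: p_def frac_binomial_pmf_eq)
    then show "p (1 - x) (n - j) * v (1 - x) (n - j) ^ 4 = p x j * v (1 - x) (n - j) ^ 4" by simp
  qed auto
  have pt: "(real j - real n * x) ^ 4 \<le> 8 * (v x j ^ 4 + v (1 - x) (n - j) ^ 4 + (1 / \<alpha>) ^ 4)" if "j \<le> n" for j
  proof -
    define m where "m = max (v x j) (v (1 - x) (n - j))"
    have xa: "0 \<le> x / \<alpha>" "x / \<alpha> \<le> 1 / \<alpha>" "0 \<le> (1 - x) / \<alpha>" "(1 - x) / \<alpha> \<le> 1 / \<alpha>"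
      using \<alpha> x by (auto simp: divide_right_mono)
    have m: "0 \<le> m" "\<bar>real j - real n * x\<bar> \<le> m + 1 / \<alpha>"
      using xa that by (auto simp: m_def v_def of_nat_diff algebra_simps abs_le_iff)
    have "(real j - real n * x) ^ 4 = \<bar>real j - real n * x\<bar> ^ 4" by simp
    also have "\<dots> \<le> (m + 1 / \<alpha>) ^ 4" using m by (intro power_mono) auto
    also have "\<dots> \<le> 8 * (m ^ 4 + (1 / \<alpha>) ^ 4)"
    proof -
      have sq: "(a + b)\<^sup>2 \<le> 2 * (a\<^sup>2 + b\<^sup>2)" for a b :: real
        using zero_le_power2[of "a - b"] by (simp add: power2_diff power2_sum)
      have "(m + 1 / \<alpha>) ^ 4 = ((m + 1 / \<alpha>)\<^sup>2)\<^sup>2" by simp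
      also have "\<dots> \<le> (2 * (m\<^sup>2 + (1 / \<alpha>)\<^sup>2))\<^sup>2" using sq by (intro power_mono) auto
      also have "\<dots> = 4 * (m\<^sup>2 + (1 / \<alpha>)\<^sup>2)\<^sup>2" by (subst power_mult_distrib) simp
      also have "\<dots> \<le> 4 * (2 * ((m\<^sup>2)\<^sup>2 + ((1 / \<alpha>)\<^sup>2)\<^sup>2))"
        by (intro mult_left_mono sq) auto
      finally show ?thesis by simp
    qed
    also have "m ^ 4 \<le> v x j ^ 4 + v (1 - x) (n - j) ^ 4"
      by (simp add: m_def max_def)
    finally show ?thesis by simp
  qed
  have "(\<Sum>j\<le>n. p x j * (real j - real n * x) ^ 4)
      \<le> (\<Sum>j\<le>n. p x j * (8 * (v x j ^ 4 + v (1 - x) (n - j) ^ 4 + (1 / \<alpha>) ^ 4)))"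
    using pt by (intro sum_mono mult_left_mono) (auto simp: p_def)
  also have "\<dots> = 8 * ((\<Sum>j\<le>n. p x j * v x j ^ 4) + (\<Sum>j\<le>n. p x j * v (1 - x) (n - j) ^ 4)
      + (1 / \<alpha>) ^ 4 * (\<Sum>j\<le>n. p x j))"
    unfolding sum_distrib_left sum.distrib[symmetric] by (intro sum.cong) (auto simp: algebra_simps)
  also have "\<dots> \<le> 8 * (3 * (real n * D)\<^sup>2 + 3 * (real n * D)\<^sup>2 + (1 / \<alpha>) ^ 4 * (real n)\<^sup>2)"
  proof -
    have "(1 / \<alpha>) ^ 4 * 1 \<le> (1 / \<alpha>) ^ 4 * (real n)\<^sup>2" using n by (intro mult_left_mono) auto
    then show ?thesis
      using m4[OF x] m4[of "1 - x"] x sum_frac_binomial_pmf[OF \<alpha> x, of n] unfolding refl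
      by (simp add: p_def)
  qed
  also have "\<dots> = 8 * (6 * D\<^sup>2 + 1 / \<alpha> ^ 4) * (real n)\<^sup>2"
    by (simp add: power_mult_distrib power_divide algebra_simps)
  finally show ?thesis by (simp add: p_def D_def)
qed

section \<open>The local difference equation\<close>

lemma powr_one_plus_linear_bound:
  fixes a :: real
  obtains \<eta> K where "\<eta> > 0" "K \<ge> 0" "\<And>y. \<bar>y\<bar> \<le> \<eta> \<Longrightarrow> \<bar>(1 + y) powr a - 1 - a * y\<bar> \<le> K * y\<^sup>2"
proof -
  have "(\<lambda>y. (1 + y) powr a - 1 - a * y) \<in> O[at 0](\<lambda>y. y\<^sup>2)"
    by real_asymp
  then obtain K where K: "K > 0" "\<forall>\<^sub>F y in at 0. norm ((1 + y) powr a - 1 - a * y) \<le> K * norm (y\<^sup>2)"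
    by (elim landau_o.bigE) auto
  then obtain d where d: "d > 0" "\<And>y. y \<noteq> 0 \<Longrightarrow> \<bar>y\<bar> < d \<Longrightarrow> norm ((1 + y) powr a - 1 - a * y) \<le> K * norm (y\<^sup>2)"
    unfolding eventually_at by (auto simp: dist_norm)
  show ?thesis
  \<comment> \<open>The punctured filter \<open>at 0\<close> says nothing at y = 0, where the
    remainder is 0; halving \<open>d\<close> gives a closed interval.\<close>
  proof (rule that[of "d / 2" K])
    show "\<bar>(1 + y) powr a - 1 - a * y\<bar> \<le> K * y\<^sup>2" if "\<bar>y\<bar> \<le> d / 2" for y
      using d(2)[of y] that d(1) by (cases "y = 0") auto
  qed (use d K in auto)
qed

text \<open>Both ratio bounds have a base of this form with bounded shifts: k = - x / \<alpha>, k' =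
  0 for the upper one, k = (1 + 1/\<alpha>) (1 - x) + x, k' = 1 + 1/\<alpha> for the lower one. One
  expansion thus serves both.\<close>

lemma local_ratio_bound:
  fixes \<alpha> x K :: real
  assumes \<alpha>: "\<alpha> > 0" and x: "0 < x" "x < 1" and K: "K \<ge> 0"
  obtains \<delta> C N where "0 < \<delta>" "\<delta> \<le> x / 2" "\<delta> \<le> (1 - x) / 2" "C \<ge> 0"
    "\<And>n t k k'. real n \<ge> N \<Longrightarrow> n \<ge> 1 \<Longrightarrow> \<bar>t\<bar> \<le> \<delta> * real n \<Longrightarrow> \<bar>k\<bar> \<le> K \<Longrightarrow> 0 \<le> k' \<Longrightarrow> k' \<le> K \<Longrightarrow>
      \<bar>(1 - (t + k) / ((real n * x + t + k') * (1 - x))) powr \<alpha> - 1 + \<alpha> * t / (real n * x * (1 - x))\<bar>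
        \<le> C * ((1 + t\<^sup>2 / real n) / real n)"
proof -
  obtain \<eta> L where \<eta>: "\<eta> > 0" and L: "L \<ge> 0"
    and taylor: "\<And>y. \<bar>y\<bar> \<le> \<eta> \<Longrightarrow> \<bar>(1 + y) powr \<alpha> - 1 - \<alpha> * y\<bar> \<le> L * y\<^sup>2"
    using powr_one_plus_linear_bound[of \<alpha>] by blast
  define c where "c = x * (1 - x) / 2"
  have c: "c > 0" using x by (simp add: c_def)
  \<comment> \<open>The last two entries keep the denominator at least \<open>real n * c\<close> and
    \<open>j\<close> away from 0 and \<open>n\<close>. The first keeps |t| \<le> \<eta> c n / 2; the
    choice of N does the same for \<open>k\<close>, so |y| \<le> \<eta>. In \<open>C\<close> the
    first summand pays for linearizing \<open>y\<close>, the second for the Taylor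
    remainder.\<close>
  define \<delta> where "\<delta> = min (\<eta> * c / 2) (min (x / 2) ((1 - x) / 2))"
  define C where "C = \<alpha> * ((1 + 2 * K) / (c * x)) + L * (2 * (1 + K\<^sup>2) / c\<^sup>2)"
  show ?thesis
  proof (rule that[of \<delta> C "2 * K / (c * \<eta>)"])
    show "0 < \<delta>" using \<eta> c x by (auto simp: \<delta>_def)
    show "\<delta> \<le> x / 2" "\<delta> \<le> (1 - x) / 2" unfolding \<delta>_def by linarith+
    show "C \<ge> 0" unfolding C_def using \<alpha> K L c x
      by (intro add_nonneg_nonneg mult_nonneg_nonneg divide_nonneg_nonneg) auto
  next
    fix n :: nat and t k k' :: real
    assume n: "2 * K / (c * \<eta>) \<le> real n" "1 \<le> n" and t: "\<bar>t\<bar> \<le> \<delta> * real n"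
      and k: "\<bar>k\<bar> \<le> K" and k': "0 \<le> k'" "k' \<le> K"
    have n0: "real n > 0" using n by simp
    define D where "D = (real n * x + t + k') * (1 - x)"
    define y where "y = - (t + k) / D"
    define u where "u = (1 + t\<^sup>2 / real n) / real n"
    have "\<delta> * real n \<le> x / 2 * real n" by (intro mult_right_mono) (auto simp: \<delta>_def)
    then have "\<delta> * real n \<le> real n * x / 2" by (simp add: mult.commute)
    then have "real n * x / 2 \<le> real n * x + t + k'" using t k' by linarith
    then have "real n * x / 2 * (1 - x) \<le> D" unfolding D_def using x by (intro mult_right_mono) auto
    then have D: "D \<ge> real n * c" by (simp add: c_def)
    then have D0: "D > 0" using n0 c mult_pos_pos[of "real n" c] by linarith
    have nc: "real n * c > 0" using n0 c by simp
    have tn: "\<bar>t\<bar> \<le> real n"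
    proof -
      have "\<delta> * real n \<le> 1 * real n" using x by (intro mult_right_mono) (auto simp: \<delta>_def)
      then show ?thesis using t by simp
    qed
    have "\<bar>y\<bar> \<le> \<eta>"
    proof -
      have "K \<le> \<eta> * c / 2 * real n" using n c \<eta> by (simp add: field_simps)
      moreover have "\<delta> * real n \<le> \<eta> * c / 2 * real n" by (intro mult_right_mono) (auto simp: \<delta>_def)
      ultimately have "\<bar>t + k\<bar> \<le> 2 * (\<eta> * c / 2 * real n)" using t k by linarith
      also have "\<dots> = \<eta> * (real n * c)" by simp
      also have "\<dots> \<le> \<eta> * D" using D \<eta> by (intro mult_left_mono) auto
      finally show ?thesis using D0 by (simp add: y_def abs_minus pos_divide_le_eq)
    qed
    from taylor[OF this] have 1: "\<bar>(1 + y) powr \<alpha> - 1 - \<alpha> * y\<bar> \<le> L * y\<^sup>2" .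
    have 2: "y\<^sup>2 \<le> 2 * (1 + K\<^sup>2) / c\<^sup>2 * u"
    proof -
      have "(t + k)\<^sup>2 \<le> 2 * (t\<^sup>2 + K\<^sup>2)"
      proof -
        have "(t + k)\<^sup>2 \<le> 2 * (t\<^sup>2 + k\<^sup>2)"
          using zero_le_power2[of "t - k"] by (simp add: power2_diff power2_sum)
        moreover have "k\<^sup>2 \<le> K\<^sup>2" using k K by (simp add: abs_le_square_iff[symmetric])
        ultimately show ?thesis by simp
      qed
      also have "\<dots> \<le> 2 * ((1 + K\<^sup>2) * (real n + t\<^sup>2))"
      proof -
        have "K\<^sup>2 * 1 \<le> K\<^sup>2 * real n" using n by (intro mult_left_mono) auto
        moreover have "0 \<le> K\<^sup>2 * t\<^sup>2" by simp
        moreover have "(1 + K\<^sup>2) * (real n + t\<^sup>2) = real n + t\<^sup>2 + K\<^sup>2 * real n + K\<^sup>2 * t\<^sup>2"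
          by (simp add: algebra_simps)
        ultimately have "t\<^sup>2 + K\<^sup>2 \<le> (1 + K\<^sup>2) * (real n + t\<^sup>2)"
          using n0 by linarith
        then show ?thesis by simp
      qed
      finally have "(t + k)\<^sup>2 / D\<^sup>2 \<le> 2 * ((1 + K\<^sup>2) * (real n + t\<^sup>2)) / (real n * c)\<^sup>2"
        using D nc n0 K by (intro frac_le power_mono) auto
      also have "\<dots> = 2 * (1 + K\<^sup>2) / c\<^sup>2 * u"
        using n0 c by (simp add: u_def field_simps power2_eq_square)
      finally show ?thesis by (simp only: y_def power_divide power2_minus)
    qed
    have 3: "\<bar>y + t / (real n * x * (1 - x))\<bar> \<le> (1 + 2 * K) / (c * x) * u"
    proof -
      have ne: "D \<noteq> 0" "real n \<noteq> 0" "x \<noteq> 0" "1 - x \<noteq> 0" using D0 n0 x by auto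
      \<comment> \<open>Over the common denominator the leading terms t n x (1 - x) cancel, leaving
        t^2 and terms of order \<open>n\<close>.\<close>
      have "y + t / (real n * x * (1 - x)) =
          (t * D - (t + k) * (real n * x * (1 - x))) / (D * (real n * x * (1 - x)))"
        using ne by (simp add: y_def divide_simps) (simp add: algebra_simps)
      also have "t * D - (t + k) * (real n * x * (1 - x)) = (t\<^sup>2 + t * k' - k * (real n * x)) * (1 - x)"
        by (simp add: D_def algebra_simps power2_eq_square)
      also have "\<dots> / (D * (real n * x * (1 - x))) = (t\<^sup>2 + t * k' - k * (real n * x)) / (D * (real n * x))"
        using ne by simp
      finally have "\<bar>y + t / (real n * x * (1 - x))\<bar> = \<bar>t\<^sup>2 + t * k' - k * (real n * x)\<bar> / (D * (real n * x))"
        using D0 n0 x by (simp add: abs_mult)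
      also have "\<dots> \<le> (1 + 2 * K) * (real n + t\<^sup>2) / ((real n * c) * (real n * x))"
      proof (intro frac_le mult_right_mono D)
        have "\<bar>t * k'\<bar> \<le> real n * K" using tn k' by (auto simp: abs_mult intro!: mult_mono)
        moreover have "\<bar>k * (real n * x)\<bar> \<le> K * (real n * 1)"
          using k x K by (auto simp: abs_mult intro!: mult_mono mult_left_le)
        moreover have "K * (real n * 1) = real n * K" by simp
        moreover have "\<bar>t\<^sup>2 + p - r\<bar> \<le> t\<^sup>2 + 2 * P" if "\<bar>p\<bar> \<le> P" "\<bar>r\<bar> \<le> P" for p r P
          using that zero_le_power2[of t] by linarith
        ultimately have "\<bar>t\<^sup>2 + t * k' - k * (real n * x)\<bar> \<le> t\<^sup>2 + 2 * (real n * K)"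
          by metis
        also have "\<dots> \<le> (1 + 2 * K) * (real n + t\<^sup>2)"
          using K n0 by (simp add: algebra_simps)
        finally show "\<bar>t\<^sup>2 + t * k' - k * (real n * x)\<bar> \<le> (1 + 2 * K) * (real n + t\<^sup>2)" .
      qed (use K n0 x nc in auto)
      also have "\<dots> = (1 + 2 * K) / (c * x) * u"
        using n0 c x by (simp add: u_def field_simps power2_eq_square)
      finally show ?thesis .
    qed
    have "(1 + y) powr \<alpha> - 1 + \<alpha> * t / (real n * x * (1 - x))
        = ((1 + y) powr \<alpha> - 1 - \<alpha> * y) + \<alpha> * (y + t / (real n * x * (1 - x)))"
      by (simp add: algebra_simps)
    also have "\<bar>\<dots>\<bar> \<le> L * (2 * (1 + K\<^sup>2) / c\<^sup>2 * u) + \<alpha> * ((1 + 2 * K) / (c * x) * u)"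
    proof -
      have "L * y\<^sup>2 \<le> L * (2 * (1 + K\<^sup>2) / c\<^sup>2 * u)" using 2 L by (intro mult_left_mono)
      moreover have "\<bar>\<alpha> * (y + t / (real n * x * (1 - x)))\<bar> \<le> \<alpha> * ((1 + 2 * K) / (c * x) * u)"
        using 3 \<alpha> unfolding abs_mult by (intro mult_mono) auto
      ultimately show ?thesis using 1 by linarith
    qed
    also have "\<dots> = C * u" by (simp add: C_def algebra_simps)
    finally show "\<bar>(1 - (t + k) / ((real n * x + t + k') * (1 - x))) powr \<alpha> - 1 + \<alpha> * t / (real n * x * (1 - x))\<bar>
        \<le> C * ((1 + t\<^sup>2 / real n) / real n)"
      by (simp only: y_def D_def u_def minus_divide_left[symmetric] add_uminus_conv_diff)
  qed
qed

text \<open>Within \<delta> n of the centre the two ratio bounds squeeze p_{j+1}. Elsewhere, or for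
  small \<open>n\<close>, the left side is merely at most a constant times p_j + p_{j+1}; as the two
  masses are not compared there, both stand on the right.\<close>

lemma frac_binomial_pmf_local_drift:
  fixes \<alpha> x :: real
  assumes \<alpha>: "\<alpha> > 0" and x: "0 < x" "x < 1"
  defines "p \<equiv> \<lambda>n. pmf (frac_binomial_pmf \<alpha> x n)"
    and "u \<equiv> \<lambda>n j. (real j - real n * x)\<^sup>2 / real n"
  obtains C where "C \<ge> 0" "\<And>n j. n \<ge> 1 \<Longrightarrow> j \<le> n \<Longrightarrow>
     \<bar>p n (Suc j) - p n j + p n j * (\<alpha> * (real j - real n * x) / (real n * x * (1 - x)))\<bar>
     \<le> C / real n * ((1 + u n j) * p n j + (1 + u n (Suc j)) * p n (Suc j))"
proof -
  define K where "K = 2 + 1 / \<alpha>"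
  have K: "K \<ge> 0" using \<alpha> by (simp add: K_def)
  obtain \<delta> C N where \<delta>: "0 < \<delta>" "\<delta> \<le> x / 2" "\<delta> \<le> (1 - x) / 2" and C: "C \<ge> 0"
    and ratio: "\<And>n t k k'. real n \<ge> N \<Longrightarrow> n \<ge> 1 \<Longrightarrow> \<bar>t\<bar> \<le> \<delta> * real n \<Longrightarrow> \<bar>k\<bar> \<le> K \<Longrightarrow> 0 \<le> k' \<Longrightarrow> k' \<le> K \<Longrightarrow>
      \<bar>(1 - (t + k) / ((real n * x + t + k') * (1 - x))) powr \<alpha> - 1 + \<alpha> * t / (real n * x * (1 - x))\<bar>
        \<le> C * ((1 + t\<^sup>2 / real n) / real n)"
    using local_ratio_bound[OF \<alpha> x K] by metis
  define s where "s = 1 + \<alpha> / (x * (1 - x))"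
  have s: "s \<ge> 1" using \<alpha> x by (simp add: s_def)
  \<comment> \<open>\<open>C\<close> serves the central range. Outside it \<open>s\<close> is the
    trivial constant, and n \<le> (|N| + 2 / \<delta>^2) (1 + u) makes it fit under (1 + u) /
    n.\<close>
  define C' where "C' = C + s * (\<bar>N\<bar> + 2 / \<delta>\<^sup>2)"
  have p0: "p n j \<ge> 0" for n j by (simp add: p_def)
  have u0: "u n j \<ge> 0" for n j by (simp add: u_def)
  have C': "C' \<ge> 0" using C s \<delta> by (simp add: C'_def)
  have main: "\<bar>p n (Suc j) - p n j + p n j * (\<alpha> * (real j - real n * x) / (real n * x * (1 - x)))\<bar>
     \<le> C' / real n * ((1 + u n j) * p n j + (1 + u n (Suc j)) * p n (Suc j))"
    if n: "n \<ge> 1" and j: "j \<le> n" for n j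
  proof -
    define t where "t = real j - real n * x"
    have n0: "real n > 0" using n by simp
    define e where "e = \<alpha> * t / (real n * x * (1 - x))"
    show ?thesis
    proof (cases "real n \<ge> N \<and> \<bar>t\<bar> \<le> \<delta> * real n")
      case True
      have half_less: "y / 2 < y" if "y > 0" for y :: real using that by simp
      have "\<delta> * real n \<le> real n * x / 2" "\<delta> * real n \<le> (real n - real n * x) / 2"
        using mult_right_mono[OF \<delta>(2), of "real n"] mult_right_mono[OF \<delta>(3), of "real n"]
        by (simp_all add: algebra_simps)
      moreover have "real n * x > 0" "real n - real n * x > 0" using n0 x by simp_all
      note half_less[OF this(1)] half_less[OF this(2)]
      ultimately have "\<delta> * real n < real n * x" "\<delta> * real n < real n - real n * x"
        by (blast intro: order.strict_trans1)+
      \<comment> \<open>The margin of \<delta> keeps \<open>j\<close> strictly between 0 and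
        \<open>n\<close>, so both ratio bounds are available.\<close>
      then have "- t < real n * x" "t < real n - real n * x" using True by linarith+
      then have "real j > 0" "real j < real n" by (simp_all add: t_def)
      then have j0: "0 < j" and jn: "j < n" by auto
      define R where "R = C * ((1 + t\<^sup>2 / real n) / real n)"
      have "p n (Suc j) \<le> p n j * (1 - e + R)"
      proof -
        have "(real n - real j + 1 / \<alpha>) * x / (real j * (1 - x))
            = 1 - (t + (- x / \<alpha>)) / ((real n * x + t + 0) * (1 - x))"
          using j0 x \<alpha> by (simp add: t_def divide_simps) (simp add: algebra_simps)
        moreover have "\<bar>(1 - (t + (- x / \<alpha>)) / ((real n * x + t + 0) * (1 - x))) powr \<alpha> - 1 + e\<bar> \<le> R"
          unfolding e_def R_def using True n \<alpha> x K
          by (intro ratio) (auto simp: K_def divide_right_mono intro: order.trans[of _ "1 / \<alpha>"])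
        ultimately have "((real n - real j + 1 / \<alpha>) * x / (real j * (1 - x))) powr \<alpha> \<le> 1 - e + R" by simp
        from mult_left_mono[OF this p0[of n j]] frac_binomial_pmf_Suc_bounds(1)[OF \<alpha> x jn j0]
        show ?thesis by (simp add: p_def)
      qed
      moreover have "p n j * (1 - e - R) \<le> p n (Suc j)"
      proof -
        define k where "k = (1 + 1 / \<alpha>) * (1 - x) + x"
        have "0 \<le> (1 + 1 / \<alpha>) * (1 - x)" using \<alpha> x by simp
        moreover have "(1 + 1 / \<alpha>) * (1 - x) \<le> (1 + 1 / \<alpha>) * 1"
          using \<alpha> x by (intro mult_left_mono) simp_all
        ultimately have k: "\<bar>k\<bar> \<le> K" using x by (simp add: k_def K_def)
        have "real j + 1 + 1 / \<alpha> > 0" using \<alpha> by (intro add_nonneg_pos) auto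
        then have ne: "(real j + 1 + 1 / \<alpha>) * (1 - x) \<noteq> 0" using x by simp
        have "(real j + 1 + 1 / \<alpha>) * (1 - x) - (t + k) = (real n - real j - 1) * x"
          by (simp add: t_def k_def algebra_simps)
        then have "(real n - real j - 1) * x / ((real j + 1 + 1 / \<alpha>) * (1 - x))
            = ((real j + 1 + 1 / \<alpha>) * (1 - x) - (t + k)) / ((real j + 1 + 1 / \<alpha>) * (1 - x))" by simp
        also have "\<dots> = 1 - (t + k) / ((real j + 1 + 1 / \<alpha>) * (1 - x))"
          by (metis ne diff_divide_distrib divide_self)
        also have "real j + 1 + 1 / \<alpha> = real n * x + t + (1 + 1 / \<alpha>)" by (simp add: t_def)
        finally have eq: "(real n - real j - 1) * x / ((real n * x + t + (1 + 1 / \<alpha>)) * (1 - x))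
            = 1 - (t + k) / ((real n * x + t + (1 + 1 / \<alpha>)) * (1 - x))" .
        have "\<bar>(1 - (t + k) / ((real n * x + t + (1 + 1 / \<alpha>)) * (1 - x))) powr \<alpha> - 1 + e\<bar> \<le> R"
          unfolding e_def R_def using True n \<alpha> k by (intro ratio) (auto simp: K_def)
        then have "1 - e - R \<le> ((real n - real j - 1) * x / ((real j + 1 + 1 / \<alpha>) * (1 - x))) powr \<alpha>"
          unfolding eq[symmetric] by (simp add: t_def algebra_simps)
        from mult_left_mono[OF this p0[of n j]] frac_binomial_pmf_Suc_bounds(2)[OF \<alpha> x jn]
        show ?thesis by (simp add: p_def)
      qed
      ultimately have "\<bar>p n (Suc j) - p n j + p n j * e\<bar> \<le> p n j * R"
        by (simp add: abs_le_iff algebra_simps)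
      also have "\<dots> = C / real n * ((1 + u n j) * p n j)"
        by (simp add: R_def u_def t_def)
      also have "\<dots> \<le> C' / real n * ((1 + u n j) * p n j + (1 + u n (Suc j)) * p n (Suc j))"
        using p0 u0 C C' s n0 by (intro mult_mono divide_right_mono) (auto simp: C'_def)
      finally show ?thesis by (simp add: e_def t_def)
    next
      case False
      have tn: "\<bar>t\<bar> \<le> real n"
      proof -
        have "real n * x \<le> real n" "real n * x \<ge> 0" using x by (simp_all add: mult_left_le)
        then show ?thesis using j by (auto simp: t_def abs_le_iff)
      qed
      have "\<bar>e\<bar> \<le> \<alpha> / (x * (1 - x))"
      proof -
        have "\<bar>e\<bar> = \<alpha> / (x * (1 - x)) * (\<bar>t\<bar> / real n)"
          using \<alpha> x n0 by (simp add: e_def abs_mult)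
        also have "\<dots> \<le> \<alpha> / (x * (1 - x)) * 1"
          using \<alpha> x n0 tn by (intro mult_left_mono) auto
        finally show ?thesis by simp
      qed
      then have "\<bar>e - 1\<bar> \<le> s" unfolding s_def by linarith
      from mult_left_mono[OF this p0[of n j]] have "\<bar>p n j * (e - 1)\<bar> \<le> p n j * s"
        using p0[of n j] by (simp add: abs_mult)
      moreover have "p n (Suc j) \<le> p n (Suc j) * s" using mult_left_mono[OF s p0[of n "Suc j"]] by simp
      moreover have "p n (Suc j) - p n j + p n j * e = p n (Suc j) + p n j * (e - 1)"
        by (simp add: algebra_simps)
      ultimately have "\<bar>p n (Suc j) - p n j + p n j * e\<bar> \<le> s * p n (Suc j) + s * p n j"
        using p0[of n "Suc j"] by (simp add: mult.commute)
      also have "\<dots> \<le> C' / real n * ((1 + u n j) * p n j + (1 + u n (Suc j)) * p n (Suc j))"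
      proof -
        \<comment> \<open>Either n < N, or |t| \<ge> \<delta> n makes the weight of order
          \<open>n\<close>. For i = j + 1 the deviation moves by 1, which t^2 \<le> 2 (1 + (t +
          1)^2) absorbs.\<close>
        have big: "real n \<le> (\<bar>N\<bar> + 2 / \<delta>\<^sup>2) * (1 + u n i)" if "i = j \<or> i = Suc j" for i
        proof (cases "real n < N")
          case True
          have "real n \<le> \<bar>N\<bar> * 1" using True by simp
          also have "\<dots> \<le> (\<bar>N\<bar> + 2 / \<delta>\<^sup>2) * (1 + u n i)" using u0 \<delta> by (intro mult_mono) auto
          finally show ?thesis .
        next
          case False': False
          then have "\<bar>t\<bar> \<ge> \<delta> * real n" using False by auto
          then have "(\<delta> * real n)\<^sup>2 \<le> t\<^sup>2" using \<delta> n0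
            by (metis abs_le_square_iff abs_of_nonneg less_imp_le mult_nonneg_nonneg)
          moreover have "t\<^sup>2 \<le> 2 * (1 + (real i - real n * x)\<^sup>2)"
          proof -
            have "t\<^sup>2 \<le> 2 * (1 + (t + 1)\<^sup>2)"
              using zero_le_power2[of "t + 2"] by (simp add: power2_eq_square algebra_simps)
            moreover have "t\<^sup>2 \<le> 2 * (1 + t\<^sup>2)" by simp
            ultimately show ?thesis using that by (auto simp: t_def algebra_simps)
          qed
          ultimately have "(\<delta> * real n)\<^sup>2 \<le> 2 * (1 + (real i - real n * x)\<^sup>2)" by linarith
          also have "\<dots> \<le> 2 * (real n * (1 + u n i))"
            using n n0 by (simp add: u_def distrib_left)
          finally have "\<delta>\<^sup>2 * real n * real n \<le> 2 * (1 + u n i) * real n"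
            by (simp add: power_mult_distrib power2_eq_square mult_ac)
          then have "\<delta>\<^sup>2 * real n \<le> 2 * (1 + u n i)" using n0 by simp
          then have "real n \<le> 2 / \<delta>\<^sup>2 * (1 + u n i)" using \<delta> by (simp add: field_simps)
          also have "\<dots> \<le> (\<bar>N\<bar> + 2 / \<delta>\<^sup>2) * (1 + u n i)" using u0 \<delta> by (intro mult_right_mono) auto
          finally show ?thesis .
        qed
        have "s \<le> C' / real n * (1 + u n i)" if "i = j \<or> i = Suc j" for i
        proof -
          have "s * real n \<le> s * ((\<bar>N\<bar> + 2 / \<delta>\<^sup>2) * (1 + u n i))"
            using big[OF that] s by (intro mult_left_mono) auto
          also have "\<dots> \<le> C' * (1 + u n i)"
            unfolding mult.assoc[symmetric] using u0[of n i] C by (intro mult_right_mono) (auto simp: C'_def)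
          finally show ?thesis using n0 by (simp add: field_simps)
        qed
        from mult_right_mono[OF this p0]
        have "s * p n i \<le> C' / real n * ((1 + u n i) * p n i)" if "i = j \<or> i = Suc j" for i
          unfolding mult.assoc[symmetric] using that by blast
        from this[of j] this[of "Suc j"] show ?thesis unfolding distrib_left[of "C' / real n"] by simp
      qed
      finally show ?thesis by (simp add: e_def t_def)
    qed
  qed
  show ?thesis using that[OF C' main] .
qed

section \<open>From the difference equation to the normal approximation\<close>

text \<open>An arbitrary mass function with approximate drift: \<open>b\<close> is the anticipated
  mean and \<open>\<kappa> * real n\<close> the anticipated variance. One constant \<open>A\<close>
  serves all hypotheses.\<close>

context
  fixes p :: "nat \<Rightarrow> real" and A \<kappa> b :: real and n :: nat
  assumes n: "n \<ge> 1" and A: "A \<ge> 0" and \<kappa>: "\<kappa> > 0" and b: "0 \<le> b" "b \<le> real n"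
    and p_nonneg: "\<And>j. p j \<ge> 0" and p_Suc: "p (Suc n) = 0" and p_sum: "(\<Sum>j\<le>n. p j) = 1"
    and drift: "\<And>j. j \<le> n \<Longrightarrow> \<bar>p (Suc j) - p j + p j * ((real j - b) / (\<kappa> * real n))\<bar>
        \<le> A / real n * ((1 + (real j - b)\<^sup>2 / real n) * p j + (1 + (real (Suc j) - b)\<^sup>2 / real n) * p (Suc j))"
    and moment: "(\<Sum>j\<le>n. p j * (1 + (real j - b)\<^sup>2 / real n)\<^sup>2) \<le> A"
    and p_0: "p 0 \<le> A / (real n)\<^sup>2"
begin

private definition "t j = real j - b"
private definition "w j = 1 + (t j)\<^sup>2 / real n"
private definition "q j = p (Suc j) - p j + p j * (t j / (\<kappa> * real n))"
text \<open>\<open>M1\<close> will bound the shift of the mean from \<open>b\<close>, and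
  \<open>M2 * sqrt (real n)\<close> the deviation of the variance from
  \<open>\<kappa> * real n\<close>; the square in \<open>M2\<close> pays for recentring.\<close>

private definition "M1 = \<kappa> * (2 * A\<^sup>2 + A)"
private definition "M2 = 4 * \<kappa> * A\<^sup>2 + \<kappa> * A + M1 + M1\<^sup>2"

private lemma n0: "real n > 0"
  using n by simp

private lemma w_ge_1: "w j \<ge> 1"
  using n0 by (simp add: w_def)

private lemma q_bound: "j \<le> n \<Longrightarrow> \<bar>q j\<bar> \<le> A / real n * (w j * p j + w (Suc j) * p (Suc j))"
  unfolding q_def w_def t_def by (rule drift)

private lemma t_Suc: "t (Suc j) = t j + 1"
  by (simp add: t_def)

private lemma sum_Suc: "(\<Sum>j\<le>n. p (Suc j) * g (Suc j)) = (\<Sum>j\<le>n. p j * g j) - p 0 * g 0" for g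
  using sum.atMost_Suc_shift[of "\<lambda>j. p j * g j" n] p_Suc by simp

private lemma sum_w2: "(\<Sum>j\<le>n. p j * (w j)\<^sup>2) \<le> A"
  using moment by (simp add: w_def t_def)

private lemma sum_w: "(\<Sum>j\<le>n. p j * w j) \<le> A"
proof -
  have "(\<Sum>j\<le>n. p j * w j) \<le> (\<Sum>j\<le>n. p j * (w j)\<^sup>2)"
    using p_nonneg w_ge_1 by (intro sum_mono mult_left_mono) (auto simp: power2_eq_square mult_le_cancel_left1)
  then show ?thesis using sum_w2 by simp
qed

private lemma sum_q: "(\<Sum>j\<le>n. \<bar>q j\<bar>) \<le> 2 * A\<^sup>2 / real n"
proof -
  have "(\<Sum>j\<le>n. \<bar>q j\<bar>) \<le> (\<Sum>j\<le>n. A / real n * (p j * w j + p (Suc j) * w (Suc j)))"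
    using q_bound by (intro sum_mono) (simp add: mult.commute)
  also have "\<dots> = A / real n * (2 * (\<Sum>j\<le>n. p j * w j) - p 0 * w 0)"
    unfolding sum_distrib_left[symmetric] sum.distrib sum_Suc by simp
  also have "\<dots> \<le> A / real n * (2 * A)"
    using sum_w p_nonneg[of 0] w_ge_1[of 0] A n0
    by (intro mult_left_mono) (auto intro: order.trans[of _ "2 * (\<Sum>j\<le>n. p j * w j)"])
  finally show ?thesis by (simp add: power2_eq_square mult_ac)
qed

private lemma mean_shift: "(\<Sum>j\<le>n. real j * p j) - b = (\<Sum>j\<le>n. p j * t j)"
proof -
  have "(\<Sum>j\<le>n. p j * t j) = (\<Sum>j\<le>n. real j * p j) - b * (\<Sum>j\<le>n. p j)"
    by (simp add: t_def sum_distrib_left sum_subtractf algebra_simps)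
  then show ?thesis by (simp add: p_sum)
qed

private lemma M_nonneg: "M1 \<ge> 0" "M2 \<ge> 0"
  using A \<kappa> by (simp_all add: M1_def M2_def)

text \<open>Summing \<open>q\<close> telescopes: the mean of \<open>t\<close> divided by \<kappa> n
  is the sum of \<open>q\<close> plus \<open>p 0\<close>, both O(1/n).\<close>

private lemma mean_bound: "\<bar>\<Sum>j\<le>n. p j * t j\<bar> \<le> M1"
proof -
  define \<tau> where "\<tau> = (\<Sum>j\<le>n. p j * t j)"
  have "(\<Sum>j\<le>n. q j) = (\<Sum>j\<le>n. p (Suc j)) - (\<Sum>j\<le>n. p j) + \<tau> / (\<kappa> * real n)"
    by (simp add: q_def \<tau>_def sum.distrib sum_subtractf sum_divide_distrib)
  also have "(\<Sum>j\<le>n. p (Suc j)) = (\<Sum>j\<le>n. p j) - p 0"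
    using sum_Suc[of "\<lambda>_. 1"] by simp
  finally have "\<tau> / (\<kappa> * real n) = (\<Sum>j\<le>n. q j) + p 0" by simp
  moreover have "\<bar>\<Sum>j\<le>n. q j\<bar> \<le> 2 * A\<^sup>2 / real n" using sum_abs sum_q by (rule order.trans)
  moreover have "p 0 \<le> A / real n"
  proof -
    have "A / (real n)\<^sup>2 \<le> A / real n"
      using n A by (intro divide_left_mono) (auto simp: power2_eq_square mult_le_cancel_left1)
    then show ?thesis using p_0 by simp
  qed
  ultimately have "\<bar>\<tau> / (\<kappa> * real n)\<bar> \<le> 2 * A\<^sup>2 / real n + A / real n"
    using p_nonneg[of 0] by linarith
  then have "\<bar>\<tau>\<bar> \<le> (2 * A\<^sup>2 / real n + A / real n) * (\<kappa> * real n)"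
    using \<kappa> n0 by (simp add: abs_divide abs_mult pos_divide_le_eq)
  also have "\<dots> = M1" using n0 by (simp add: M1_def field_simps)
  finally show ?thesis by (simp add: \<tau>_def)
qed

private lemma abs_t_le: "\<bar>t j\<bar> \<le> sqrt (real n) * w j"
proof -
  have "2 * (\<bar>t j\<bar> * sqrt (real n)) \<le> real n + (t j)\<^sup>2"
    using zero_le_power2[of "\<bar>t j\<bar> - sqrt (real n)"] n0 by (simp add: power2_diff algebra_simps)
  also have "\<dots> = real n * w j" using n0 by (simp add: w_def distrib_left)
  moreover have "0 \<le> \<bar>t j\<bar> * sqrt (real n)" by simp
  ultimately have "\<bar>t j\<bar> * sqrt (real n) \<le> real n * w j" by linarith
  also have "\<dots> = sqrt (real n) * w j * sqrt (real n)" using n0 by simp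
  finally show ?thesis by (rule mult_right_le_imp_le) (use n0 in simp)
qed

text \<open>|t| \<le> sqrt n w trades the factor \<open>t\<close> for a second weight. The mixed
  product w_{j+1} w_j is reduced to 3 w_j^2, so the mean of w^2 is counted 3 + 1 times.\<close>

private lemma sum_t_q: "(\<Sum>j\<le>n. \<bar>t (Suc j) * q j\<bar>) \<le> 4 * A\<^sup>2 / sqrt (real n)"
proof -
  have wS: "w (Suc j) \<le> 3 * w j" for j
  proof -
    have "(t j + 1)\<^sup>2 \<le> 2 * (t j)\<^sup>2 + 2 * real n"
      using zero_le_power2[of "t j - 1"] n by (simp add: power2_eq_square algebra_simps)
    then have "(t j + 1)\<^sup>2 / real n \<le> (2 * (t j)\<^sup>2 + 2 * real n) / real n"
      using n0 by (intro divide_right_mono) auto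
    also have "\<dots> = 2 * ((t j)\<^sup>2 / real n) + 2" using n0 by (simp add: add_divide_distrib)
    finally have "(t j + 1)\<^sup>2 / real n \<le> 2 * ((t j)\<^sup>2 / real n) + 2" .
    moreover have "0 \<le> (t j)\<^sup>2 / real n" using n0 by simp
    moreover have "1 + a \<le> 3 * (1 + c)" if "a \<le> 2 * c + 2" "0 \<le> c" for a c :: real
      using that by simp
    ultimately show ?thesis unfolding w_def t_Suc by blast
  qed
  have "(\<Sum>j\<le>n. \<bar>t (Suc j) * q j\<bar>)
      \<le> (\<Sum>j\<le>n. A / real n * sqrt (real n) * (3 * (p j * (w j)\<^sup>2) + p (Suc j) * (w (Suc j))\<^sup>2))"
  proof (intro sum_mono)
    fix j assume "j \<in> {..n}"
    then have j: "j \<le> n" by simp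
    have "\<bar>t (Suc j) * q j\<bar> \<le> (sqrt (real n) * w (Suc j)) * (A / real n * (w j * p j + w (Suc j) * p (Suc j)))"
      unfolding abs_mult using abs_t_le[of "Suc j"] q_bound[OF j] w_ge_1[of "Suc j"] by (intro mult_mono) auto
    also have "\<dots> = A / real n * sqrt (real n) * (w (Suc j) * (w j * p j) + p (Suc j) * (w (Suc j))\<^sup>2)"
      by (simp add: algebra_simps power2_eq_square)
    also have "\<dots> \<le> A / real n * sqrt (real n) * (3 * (p j * (w j)\<^sup>2) + p (Suc j) * (w (Suc j))\<^sup>2)"
    proof (intro mult_left_mono add_right_mono)
      have "w (Suc j) * (w j * p j) \<le> 3 * w j * (w j * p j)"
        using wS[of j] w_ge_1[of j] p_nonneg[of j] by (intro mult_right_mono) auto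
      then show "w (Suc j) * (w j * p j) \<le> 3 * (p j * (w j)\<^sup>2)"
        by (simp add: power2_eq_square mult_ac)
    qed (use A in auto)
    finally show "\<bar>t (Suc j) * q j\<bar> \<le> A / real n * sqrt (real n) * (3 * (p j * (w j)\<^sup>2) + p (Suc j) * (w (Suc j))\<^sup>2)" .
  qed
  also have "\<dots> = A / real n * sqrt (real n) * (4 * (\<Sum>j\<le>n. p j * (w j)\<^sup>2) - p 0 * (w 0)\<^sup>2)"
    unfolding sum_distrib_left[symmetric] sum.distrib sum_Suc[of "\<lambda>j. (w j)\<^sup>2"] by simp
  also have "\<dots> \<le> A / real n * sqrt (real n) * (4 * A)"
    using sum_w2 p_nonneg[of 0] A n0
    by (intro mult_left_mono) (auto intro: order.trans[of _ "4 * (\<Sum>j\<le>n. p j * (w j)\<^sup>2)"])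
  also have "\<dots> = 4 * A\<^sup>2 / sqrt (real n)"
    using n0 by (simp add: field_simps power2_eq_square)
  finally show ?thesis .
qed

text \<open>Testing against t_{j+1}, summation by parts produces the total mass 1 against T /
  (\<kappa> n), with T the second moment. The boundary term \<open>p 0 * b\<close> can have b of
  order \<open>n\<close>, so it takes p_0 = O(1/n^2) to make it O(1/n).\<close>

private lemma second_moment_bound:
  "\<bar>(\<Sum>j\<le>n. p j * (t j)\<^sup>2) - \<kappa> * real n\<bar> \<le> (4 * \<kappa> * A\<^sup>2 + \<kappa> * A + M1) * sqrt (real n)"
proof -
  define \<tau> where "\<tau> = (\<Sum>j\<le>n. p j * t j)"
  define T where "T = (\<Sum>j\<le>n. p j * (t j)\<^sup>2)"
  define r where "r = sqrt (real n)"
  have r: "r \<ge> 1" "real n = r * r" using n by (simp_all add: r_def)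
  have t0: "t 0 = - b" by (simp add: t_def)
  have "(\<Sum>j\<le>n. t (Suc j) * q j) = (\<Sum>j\<le>n. p (Suc j) * t (Suc j)) - (\<Sum>j\<le>n. p j * t j) - (\<Sum>j\<le>n. p j)
      + ((\<Sum>j\<le>n. p j * (t j)\<^sup>2) + (\<Sum>j\<le>n. p j * t j)) / (\<kappa> * real n)"
    unfolding sum.distrib[symmetric] sum_subtractf[symmetric] sum_divide_distrib
    by (intro sum.cong) (simp_all add: q_def t_Suc algebra_simps power2_eq_square add_divide_distrib)
  also have "(\<Sum>j\<le>n. p (Suc j) * t (Suc j)) = \<tau> + p 0 * b"
    unfolding sum_Suc[of t] by (simp add: \<tau>_def t0)
  finally have "(T + \<tau>) / (\<kappa> * real n) - 1 = (\<Sum>j\<le>n. t (Suc j) * q j) - p 0 * b"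
    by (simp add: p_sum T_def \<tau>_def)
  then have "T - \<kappa> * real n = \<kappa> * real n * ((\<Sum>j\<le>n. t (Suc j) * q j) - p 0 * b) - \<tau>"
    using \<kappa> n0 by (simp add: field_simps)
  moreover have "\<bar>\<kappa> * real n * ((\<Sum>j\<le>n. t (Suc j) * q j) - p 0 * b)\<bar> \<le> \<kappa> * real n * (4 * A\<^sup>2 / r + A / real n)"
  proof -
    have "\<bar>\<Sum>j\<le>n. t (Suc j) * q j\<bar> \<le> 4 * A\<^sup>2 / r" unfolding r_def using sum_abs sum_t_q by (rule order.trans)
    moreover have "p 0 * b \<le> A / (real n)\<^sup>2 * real n"
      using p_0 b A by (intro mult_mono) auto
    moreover have "A / (real n)\<^sup>2 * real n = A / real n" by (simp add: power2_eq_square)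
    moreover have "0 \<le> p 0 * b" using p_nonneg b by simp
    ultimately have "\<bar>(\<Sum>j\<le>n. t (Suc j) * q j) - p 0 * b\<bar> \<le> 4 * A\<^sup>2 / r + A / real n" by linarith
    then show ?thesis using \<kappa> n0 by (simp only: abs_mult) (intro mult_mono, auto)
  qed
  moreover have "\<kappa> * real n * (4 * A\<^sup>2 / r + A / real n) = 4 * \<kappa> * A\<^sup>2 * r + \<kappa> * A"
    using r n0 by (simp add: field_simps)
  moreover have "\<kappa> * A \<le> \<kappa> * A * r" "M1 \<le> M1 * r"
    using mult_left_mono[OF r(1), of "\<kappa> * A"] mult_left_mono[OF r(1), of M1] A \<kappa> M_nonneg by simp_all
  ultimately have "\<bar>T - \<kappa> * real n\<bar> \<le> 4 * \<kappa> * A\<^sup>2 * r + \<kappa> * A * r + M1 * r"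
    using mean_bound unfolding \<tau>_def by linarith
  then show ?thesis by (simp add: T_def r_def distrib_right)
qed

private lemma variance_eq:
  defines "m \<equiv> \<Sum>j\<le>n. real j * p j"
  shows "(\<Sum>j\<le>n. p j * (real j - m)\<^sup>2) = (\<Sum>j\<le>n. p j * (t j)\<^sup>2) - (\<Sum>j\<le>n. p j * t j)\<^sup>2"
proof -
  define \<tau> where "\<tau> = (\<Sum>j\<le>n. p j * t j)"
  have m: "m = b + \<tau>" using mean_shift by (simp add: m_def \<tau>_def)
  have "(\<Sum>j\<le>n. p j * (real j - m)\<^sup>2)
      = (\<Sum>j\<le>n. p j * (t j)\<^sup>2) - 2 * \<tau> * (\<Sum>j\<le>n. p j * t j) + \<tau>\<^sup>2 * (\<Sum>j\<le>n. p j)"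
    unfolding m sum_distrib_left sum.distrib[symmetric] sum_subtractf[symmetric]
    by (intro sum.cong) (simp_all add: t_def power2_eq_square algebra_simps)
  then show ?thesis by (simp add: p_sum \<tau>_def power2_eq_square)
qed

private lemma variance_bound:
  defines "m \<equiv> \<Sum>j\<le>n. real j * p j"
  shows "\<bar>(\<Sum>j\<le>n. p j * (real j - m)\<^sup>2) - \<kappa> * real n\<bar> \<le> M2 * sqrt (real n)"
proof -
  have "(\<Sum>j\<le>n. p j * t j)\<^sup>2 \<le> M1\<^sup>2"
    using mean_bound M_nonneg by (simp add: abs_le_square_iff[symmetric])
  moreover have "M1\<^sup>2 * 1 \<le> M1\<^sup>2 * sqrt (real n)" using n by (intro mult_left_mono) auto
  moreover have "0 \<le> (\<Sum>j\<le>n. p j * t j)\<^sup>2" by simp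
  moreover have "M2 * sqrt (real n) = (4 * \<kappa> * A\<^sup>2 + \<kappa> * A + M1) * sqrt (real n) + M1\<^sup>2 * sqrt (real n)"
    by (simp add: M2_def distrib_right)
  ultimately show ?thesis
    using second_moment_bound unfolding m_def variance_eq by (simp only: abs_le_iff) linarith
qed

lemma approximate_drift_normal_approximation:
  fixes z :: real
  defines "m \<equiv> \<Sum>j\<le>n. real j * p j"
  defines "V \<equiv> \<Sum>j\<le>n. p j * (real j - m)\<^sup>2"
  defines "K1 \<equiv> \<kappa> * (2 * A\<^sup>2 + A)"
  defines "K2 \<equiv> 4 * \<kappa> * A\<^sup>2 + \<kappa> * A + K1 + K1\<^sup>2"
  defines "C \<equiv> 2 * K2 / \<kappa> + (3 * sqrt (2 * \<kappa>) + 8) * (A + 2 * A\<^sup>2 + A * (2 * K2 / \<kappa>\<^sup>2 + 2 * K1 / \<kappa>))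
      + 19 / sqrt (\<kappa> / 2)"
  shows "\<bar>(\<Sum>j\<in>{j. j \<le> n \<and> (real j - m) / sqrt V \<le> z}. p j) - std_normal_cdf z\<bar> \<le> C / sqrt (real n)"
proof -
  define r where "r = sqrt (real n)"
  have r: "r \<ge> 1" "real n = r * r" using n by (simp_all add: r_def)
  have K: "K1 = M1" "K2 = M2" by (simp_all add: K1_def K2_def M1_def M2_def)
  define E where "E = 2 * M2 / \<kappa>\<^sup>2 + 2 * M1 / \<kappa>"
  have E: "E \<ge> 0" using M_nonneg \<kappa> by (simp add: E_def)
  define D where "D = A + 2 * A\<^sup>2 + A * E"
  have D: "D \<ge> 0" using A E by (simp add: D_def)
  have C: "C = 2 * M2 / \<kappa> + (3 * sqrt (2 * \<kappa>) + 8) * D + 19 / sqrt (\<kappa> / 2)"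
    by (simp add: C_def K D_def E_def)
  have rest: "0 \<le> (3 * sqrt (2 * \<kappa>) + 8) * D" "0 \<le> 19 / sqrt (\<kappa> / 2)" "0 \<le> 2 * M2 / \<kappa>"
    using D \<kappa> M_nonneg by auto
  show ?thesis
  \<comment> \<open>For small \<open>n\<close> the distance, at most 1, is covered by the first
    summand of \<open>C\<close>. Otherwise the variance bound places \<open>V\<close> between
    \<kappa> n / 2 and 2 \<kappa> n.\<close>
  proof (cases "r \<le> 2 * M2 / \<kappa>")
    case True
    have "(\<Sum>j\<in>{j. j \<le> n \<and> (real j - m) / sqrt V \<le> z}. p j) \<le> (\<Sum>j\<le>n. p j)"
      using p_nonneg by (intro sum_mono2) auto
    moreover have "(\<Sum>j\<in>{j. j \<le> n \<and> (real j - m) / sqrt V \<le> z}. p j) \<ge> 0"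
      using p_nonneg by (intro sum_nonneg) auto
    ultimately have "\<bar>(\<Sum>j\<in>{j. j \<le> n \<and> (real j - m) / sqrt V \<le> z}. p j) - std_normal_cdf z\<bar> \<le> 1"
      using std_normal_cdf_bounds[of z] p_sum by linarith
    also have "1 \<le> C / r"
    proof -
      have "r \<le> C" using True rest unfolding C by linarith
      then show ?thesis using r by (simp add: pos_le_divide_eq)
    qed
    finally show ?thesis by (simp add: r_def)
  next
    case False
    have Vb: "\<bar>V - \<kappa> * real n\<bar> \<le> M2 * r"
      using variance_bound by (simp add: V_def m_def r_def)
    have "M2 * r \<le> \<kappa> * real n / 2"
    proof -
      have "M2 \<le> \<kappa> / 2 * r" using False \<kappa> by (simp add: field_simps)
      then have "M2 * r \<le> \<kappa> / 2 * r * r" using r by (intro mult_right_mono) auto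
      then show ?thesis using r by (simp add: mult.assoc)
    qed
    with Vb have V: "\<kappa> * real n / 2 \<le> V" "V \<le> 2 * \<kappa> * real n"
      using mult_pos_pos[OF \<kappa> n0] by (simp_all only: abs_le_iff) linarith+
    have kn: "\<kappa> * real n > 0" using \<kappa> n0 by simp
    then have V0: "V > 0" using V by linarith
    define s where "s = sqrt V"
    have s0: "s > 0" and s2: "s\<^sup>2 = V" using V0 by (simp_all add: s_def)
    define q' where "q' = (\<lambda>j. p (Suc j) - p j + p j * (real j - m) / s\<^sup>2)"
    define \<tau> where "\<tau> = (\<Sum>j\<le>n. p j * t j)"
    have \<tau>: "\<bar>\<tau>\<bar> \<le> M1" using mean_bound by (simp add: \<tau>_def)
    have mt: "real j - m = t j - \<tau>" for j using mean_shift by (simp add: m_def \<tau>_def t_def)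
    have q': "\<bar>q' j\<bar> \<le> \<bar>q j\<bar> + p j * w j * (E / real n)" for j
    proof -
      \<comment> \<open>Cost of exchanging \<open>b\<close> and \<kappa> n for the exact mean and
        variance: |t| \<le> sqrt n w meets a variance error O(sqrt n) over a denominator of order
        n^2. The two terms give the two summands of \<open>E\<close>.\<close>
      have "(t j - \<tau>) / V - t j / (\<kappa> * real n) = t j * (\<kappa> * real n - V) / (V * (\<kappa> * real n)) - \<tau> / V"
        using V0 kn \<kappa> n0 by (simp add: field_simps)
      also have "\<bar>\<dots>\<bar> \<le> w j * (2 * M2 / \<kappa>\<^sup>2) / real n + w j * (2 * M1 / \<kappa>) / real n"
      proof -
        have tw: "\<bar>t j\<bar> \<le> r * w j" using abs_t_le[of j] by (simp add: r_def)
        have "\<bar>t j * (\<kappa> * real n - V) / (V * (\<kappa> * real n))\<bar> = \<bar>t j\<bar> * \<bar>V - \<kappa> * real n\<bar> / (V * (\<kappa> * real n))"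
          using V0 kn \<kappa> n0 by (simp add: abs_mult abs_minus_commute)
        also have "\<dots> \<le> (r * w j) * (M2 * r) / (\<kappa> * real n / 2 * (\<kappa> * real n))"
          using tw Vb V kn w_ge_1[of j] r M_nonneg \<kappa> by (intro frac_le mult_mono) auto
        also have "\<dots> = w j * (2 * M2 / \<kappa>\<^sup>2) / real n"
          using r \<kappa> by (simp add: field_simps power2_eq_square)
        finally have 1: "\<bar>t j * (\<kappa> * real n - V) / (V * (\<kappa> * real n))\<bar> \<le> w j * (2 * M2 / \<kappa>\<^sup>2) / real n" .
        have "\<bar>\<tau> / V\<bar> = \<bar>\<tau>\<bar> / V" using V0 by simp
        also have "\<dots> \<le> M1 / (\<kappa> * real n / 2)"
          using \<tau> V kn by (intro frac_le) auto
        also have "\<dots> = 1 * (2 * M1 / \<kappa>) / real n" by simp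
        also have "\<dots> \<le> w j * (2 * M1 / \<kappa>) / real n"
          using w_ge_1[of j] M_nonneg \<kappa> by (intro divide_right_mono mult_right_mono) auto
        finally show ?thesis using 1 by linarith
      qed
      also have "\<dots> = w j * (E / real n)" by (simp add: E_def distrib_left add_divide_distrib)
      finally have *: "\<bar>(t j - \<tau>) / V - t j / (\<kappa> * real n)\<bar> \<le> w j * (E / real n)" .
      have "q' j = q j + p j * ((t j - \<tau>) / V - t j / (\<kappa> * real n))"
        by (simp add: q'_def q_def s2 mt right_diff_distrib)
      moreover have "\<bar>p j * ((t j - \<tau>) / V - t j / (\<kappa> * real n))\<bar> \<le> p j * (w j * (E / real n))"
        unfolding abs_mult using p_nonneg[of j] * by (intro mult_mono) auto
      ultimately show ?thesis by (simp add: mult.assoc)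
    qed
    define Q where "Q = p 0 + (\<Sum>j\<le>n. \<bar>q' j\<bar>)"
    have Q: "Q \<le> D / real n"
    proof -
      have "(\<Sum>j\<le>n. \<bar>q' j\<bar>) \<le> (\<Sum>j\<le>n. \<bar>q j\<bar> + p j * w j * (E / real n))"
        by (intro sum_mono q')
      also have "\<dots> = (\<Sum>j\<le>n. \<bar>q j\<bar>) + (\<Sum>j\<le>n. p j * w j) * (E / real n)"
        by (simp only: sum.distrib sum_distrib_right)
      also have "\<dots> \<le> 2 * A\<^sup>2 / real n + A * (E / real n)"
        using sum_q sum_w E n0 by (intro add_mono mult_right_mono) auto
      finally have "(\<Sum>j\<le>n. \<bar>q' j\<bar>) \<le> 2 * A\<^sup>2 / real n + A * (E / real n)" .
      moreover have "A / (real n)\<^sup>2 \<le> A / real n"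
        using n A by (intro divide_left_mono) (auto simp: power2_eq_square mult_le_cancel_left1)
      ultimately have "Q \<le> A / real n + 2 * A\<^sup>2 / real n + A * (E / real n)" using p_0 by (simp add: Q_def)
      then show ?thesis by (simp add: D_def add_divide_distrib)
    qed
    have s: "sqrt (\<kappa> / 2) * r \<le> s" "s \<le> sqrt (2 * \<kappa>) * r"
      using V unfolding s_def r_def real_sqrt_mult[symmetric] by (auto intro!: real_sqrt_le_mono)
    have "\<bar>(\<Sum>j\<in>{j. j \<le> n \<and> (real j - m) / s \<le> z}. p j) - std_normal_cdf z\<bar> \<le> (3 * s + 8) * Q + 19 / s"
      unfolding Q_def q'_def
      by (rule stein_discrete_bound[OF p_nonneg p_Suc p_sum s0]) (simp add: s2 V_def)
    \<comment> \<open>\<open>s\<close> is of order sqrt n and \<open>Q\<close> of order 1/n; the 8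
      is absorbed by r \<ge> 1.\<close>
    also have "\<dots> \<le> ((3 * sqrt (2 * \<kappa>) + 8) * r) * (D / real n) + 19 / (sqrt (\<kappa> / 2) * r)"
    proof (intro add_mono mult_mono divide_left_mono)
      show "3 * s + 8 \<le> (3 * sqrt (2 * \<kappa>) + 8) * r" using s r by (simp add: distrib_right)
      show "0 \<le> Q" using p_nonneg by (auto simp: Q_def intro!: add_nonneg_nonneg sum_nonneg)
      show "0 \<le> (3 * sqrt (2 * \<kappa>) + 8) * r" using r \<kappa> by simp
      show "0 < s * (sqrt (\<kappa> / 2) * r)" using s0 r \<kappa> by simp
    qed (use Q s in auto)
    also have "\<dots> = ((3 * sqrt (2 * \<kappa>) + 8) * D + 19 / sqrt (\<kappa> / 2)) / r"
      using r by (simp add: add_divide_distrib)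
    also have "\<dots> \<le> C / r" using rest r by (intro divide_right_mono) (auto simp: C)
    finally show ?thesis by (simp add: s_def r_def)
  qed
qed

end

section \<open>Application to the fractional binomial distribution\<close>

lemma frac_binomial_pmf_sum_bound:
  fixes \<alpha> x :: real
  assumes \<alpha>: "\<alpha> > 0" and x: "0 < x" "x < 1"
  defines "p \<equiv> \<lambda>n. pmf (frac_binomial_pmf \<alpha> x n)"
  defines "m \<equiv> \<lambda>n. \<Sum>j\<le>n. real j * p n j"
  defines "V \<equiv> \<lambda>n. \<Sum>j\<le>n. p n j * (real j - m n)\<^sup>2"
  shows "\<exists>C. \<forall>n z. n \<ge> 1 \<longrightarrow>
    \<bar>(\<Sum>j\<in>{j. j \<le> n \<and> (real j - m n) / sqrt (V n) \<le> z}. p n j) - std_normal_cdf z\<bar> \<le> C / sqrt (real n)"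
proof -
  obtain B where B: "B \<ge> 0" and drift: "\<And>n j. n \<ge> 1 \<Longrightarrow> j \<le> n \<Longrightarrow>
     \<bar>p n (Suc j) - p n j + p n j * (\<alpha> * (real j - real n * x) / (real n * x * (1 - x)))\<bar>
     \<le> B / real n * ((1 + (real j - real n * x)\<^sup>2 / real n) * p n j
        + (1 + (real (Suc j) - real n * x)\<^sup>2 / real n) * p n (Suc j))"
    using frac_binomial_pmf_local_drift[OF \<alpha> x] unfolding p_def by metis
  define M where "M = 8 * (6 * ((1 + \<alpha>) / \<alpha>)\<^sup>2 + 1 / \<alpha> ^ 4)"
  have moment: "(\<Sum>j\<le>n. p n j * (real j - real n * x) ^ 4) \<le> M * (real n)\<^sup>2" if "n \<ge> 1" for n
    unfolding p_def M_def by (rule frac_binomial_pmf_fourth_moment[OF \<alpha> x that])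
  have M: "M \<ge> 0" using \<alpha> by (simp add: M_def)
  \<comment> \<open>The summands dominate, in turn, the drift constant, the mean of the squared
    weight, and n^2 times the mass at 0.\<close>
  define A where "A = B + 2 + 2 * M + M / x ^ 4"
  have A: "A \<ge> 0" "B \<le> A" "2 + 2 * M \<le> A" "M / x ^ 4 \<le> A" using B M x by (auto simp: A_def)
  define \<kappa> where "\<kappa> = x * (1 - x) / \<alpha>"
  have \<kappa>: "\<kappa> > 0" using \<alpha> x by (simp add: \<kappa>_def)
  have p0: "p n j \<ge> 0" for n j by (simp add: p_def)
  have sum1: "(\<Sum>j\<le>n. p n j) = 1" for n
    unfolding p_def by (rule sum_frac_binomial_pmf[OF \<alpha> x])
  define K1 where "K1 = \<kappa> * (2 * A\<^sup>2 + A)"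
  define K2 where "K2 = 4 * \<kappa> * A\<^sup>2 + \<kappa> * A + K1 + K1\<^sup>2"
  \<comment> \<open>The constant of the abstract bound is written out so that it is fixed before
    \<open>n\<close> and \<open>z\<close>.\<close>
  define C where "C = 2 * K2 / \<kappa>
      + (3 * sqrt (2 * \<kappa>) + 8) * (A + 2 * A\<^sup>2 + A * (2 * K2 / \<kappa>\<^sup>2 + 2 * K1 / \<kappa>))
      + 19 / sqrt (\<kappa> / 2)"
  show ?thesis
  proof (intro exI[of _ C] allI impI)
    fix n :: nat and z :: real assume n: "n \<ge> 1"
    then have n0: "real n > 0" by simp
    show "\<bar>(\<Sum>j\<in>{j. j \<le> n \<and> (real j - m n) / sqrt (V n) \<le> z}. p n j) - std_normal_cdf z\<bar>
      \<le> C / sqrt (real n)"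
      unfolding V_def m_def C_def K2_def K1_def
    proof (rule approximate_drift_normal_approximation[where b = "real n * x"])
      show "0 \<le> real n * x" "real n * x \<le> real n" using x by (auto intro: mult_left_le)
      show "p n (Suc n) = 0" by (simp add: p_def frac_binomial_pmf_eq[OF \<alpha> x])
      show "\<bar>p n (Suc j) - p n j + p n j * ((real j - real n * x) / (\<kappa> * real n))\<bar>
        \<le> A / real n * ((1 + (real j - real n * x)\<^sup>2 / real n) * p n j
          + (1 + (real (Suc j) - real n * x)\<^sup>2 / real n) * p n (Suc j))" if j: "j \<le> n" for j
      proof -
        have "(real j - real n * x) / (\<kappa> * real n) = \<alpha> * (real j - real n * x) / (real n * x * (1 - x))"
          using \<alpha> by (simp add: \<kappa>_def mult_ac)
        then have "\<bar>p n (Suc j) - p n j + p n j * ((real j - real n * x) / (\<kappa> * real n))\<bar>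
          \<le> B / real n * ((1 + (real j - real n * x)\<^sup>2 / real n) * p n j
          + (1 + (real (Suc j) - real n * x)\<^sup>2 / real n) * p n (Suc j))"
          using drift[OF n j] by simp
        also have "\<dots> \<le> A / real n * ((1 + (real j - real n * x)\<^sup>2 / real n) * p n j
          + (1 + (real (Suc j) - real n * x)\<^sup>2 / real n) * p n (Suc j))"
          using A p0 n0 by (intro mult_right_mono divide_right_mono add_nonneg_nonneg mult_nonneg_nonneg) auto
        finally show ?thesis .
      qed
      show "(\<Sum>j\<le>n. p n j * (1 + (real j - real n * x)\<^sup>2 / real n)\<^sup>2) \<le> A"
      proof -
        have "(1 + y\<^sup>2 / real n)\<^sup>2 \<le> 2 + 2 * (y ^ 4 / (real n)\<^sup>2)" for y :: real
        proof -
          have "(1 + a)\<^sup>2 \<le> 2 + 2 * a\<^sup>2" for a :: real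
            using zero_le_power2[of "1 - a"] by (simp add: power2_diff power2_sum)
          from this[of "y\<^sup>2 / real n"] show ?thesis by (simp add: power_divide)
        qed
        then have "(\<Sum>j\<le>n. p n j * (1 + (real j - real n * x)\<^sup>2 / real n)\<^sup>2)
          \<le> (\<Sum>j\<le>n. p n j * (2 + 2 * ((real j - real n * x) ^ 4 / (real n)\<^sup>2)))"
          using p0 by (intro sum_mono mult_left_mono)
        also have "\<dots> = 2 * (\<Sum>j\<le>n. p n j) + 2 * (\<Sum>j\<le>n. p n j * (real j - real n * x) ^ 4) / (real n)\<^sup>2"
          unfolding sum_distrib_left sum_divide_distrib sum.distrib[symmetric]
          by (intro sum.cong) (simp_all add: algebra_simps)
        also have "\<dots> \<le> 2 * 1 + 2 * (M * (real n)\<^sup>2) / (real n)\<^sup>2"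
          using moment[OF n] sum1[of n] n0 by (intro add_mono divide_right_mono) auto
        also have "\<dots> = 2 + 2 * M" using n0 by simp
        finally show ?thesis using A by simp
      qed
      show "p n 0 \<le> A / (real n)\<^sup>2"
      proof -
        \<comment> \<open>The mass at 0 sits at distance n x from the centre, so the fourth moment
          alone forces it to be O(1/n^2).\<close>
        have "p n 0 * (real 0 - real n * x) ^ 4 \<le> (\<Sum>j\<le>n. p n j * (real j - real n * x) ^ 4)"
          using p0 by (intro member_le_sum) auto
        then have "p n 0 * (real n * x) ^ 4 \<le> M * (real n)\<^sup>2" using moment[OF n] by simp
        then have "p n 0 * (real n)\<^sup>2 * ((real n)\<^sup>2 * x ^ 4) \<le> M / x ^ 4 * ((real n)\<^sup>2 * x ^ 4)"
          using x by (simp add: power_mult_distrib mult_ac flip: power_add)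
        then have "p n 0 * (real n)\<^sup>2 \<le> M / x ^ 4" by (rule mult_right_le_imp_le) (use n0 x in auto)
        then have "p n 0 * (real n)\<^sup>2 \<le> A" using A by simp
        then show ?thesis using n0 by (simp add: pos_le_divide_eq)
      qed
    qed (use n A \<kappa> p0 sum1 in auto)
  qed
qed

theorem theorem2p6:
  fixes \<alpha> x :: real
  assumes "\<alpha> > 0" and "0 < x" and "x < 1"
  shows "\<exists>C>0. \<forall>n\<ge>1. \<forall>(M :: 'a measure) (S :: 'a \<Rightarrow> nat).
    prob_space M \<longrightarrow> S \<in> measurable M (count_space UNIV) \<longrightarrow>
    distr M (count_space UNIV) S = measure_pmf (frac_binomial_pmf \<alpha> x n) \<longrightarrow>
    (SUP z. \<bar>\<P>(\<omega> in M. standardized M (\<lambda>\<omega>. real (S \<omega>)) \<omega> \<le> z) - std_normal_cdf z\<bar>)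
      \<le> C / sqrt (real n)"
proof -
  define p where "p = (\<lambda>n. pmf (frac_binomial_pmf \<alpha> x n))"
  define m where "m = (\<lambda>n. \<Sum>j\<le>n. real j * p n j)"
  define V where "V = (\<lambda>n. \<Sum>j\<le>n. p n j * (real j - m n)\<^sup>2)"
  obtain C where C: "\<forall>n z. n \<ge> 1 \<longrightarrow>
    \<bar>(\<Sum>j\<in>{j. j \<le> n \<and> (real j - m n) / sqrt (V n) \<le> z}. p n j) - std_normal_cdf z\<bar> \<le> C / sqrt (real n)"
    using frac_binomial_pmf_sum_bound[OF assms] unfolding V_def m_def p_def ..
  have supp: "j \<le> n" if "j \<in> set_pmf (frac_binomial_pmf \<alpha> x n)" for j n
    using that by (auto simp: set_pmf_eq frac_binomial_pmf_eq[OF assms] split: if_splits)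
  show ?thesis
  \<comment> \<open>\<open>C\<close> comes without a sign, and a positive constant is
    demanded.\<close>
  proof (intro exI[of _ "max 1 C"] conjI allI impI)
    fix n :: nat and M :: "'a measure" and S :: "'a \<Rightarrow> nat"
    assume n: "n \<ge> 1" and M: "prob_space M" and S: "S \<in> measurable M (count_space UNIV)"
      and distr: "distr M (count_space UNIV) S = measure_pmf (frac_binomial_pmf \<alpha> x n)"
    have expect: "(\<integral>\<omega>. f (S \<omega>) \<partial>M) = (\<Sum>j\<le>n. f j * p n j)" for f :: "nat \<Rightarrow> real"
    proof -
      have "(\<integral>\<omega>. f (S \<omega>) \<partial>M) = (\<integral>j. f j \<partial>distr M (count_space UNIV) S)"
        using S by (intro integral_distr[symmetric]) auto
      also have "\<dots> = (\<Sum>j\<le>n. f j * p n j)"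
        unfolding distr p_def by (intro integral_measure_pmf_real) (auto intro: supp)
      finally show ?thesis .
    qed
    have mean: "prob_space.expectation M (\<lambda>\<omega>. real (S \<omega>)) = m n"
      using expect[of real] by (simp add: m_def)
    have var: "prob_space.variance M (\<lambda>\<omega>. real (S \<omega>)) = V n"
      using expect[of "\<lambda>j. (real j - m n)\<^sup>2"] by (simp add: mean V_def mult.commute)
    have prob: "\<P>(\<omega> in M. standardized M (\<lambda>\<omega>. real (S \<omega>)) \<omega> \<le> z)
        = (\<Sum>j\<in>{j. j \<le> n \<and> (real j - m n) / sqrt (V n) \<le> z}. p n j)" for z
    proof -
      have "\<P>(\<omega> in M. standardized M (\<lambda>\<omega>. real (S \<omega>)) \<omega> \<le> z)
          = measure M (S -` {j. (real j - m n) / sqrt (V n) \<le> z} \<inter> space M)"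
        unfolding standardized_def mean var[unfolded mean] by (intro arg_cong[where f = "measure M"]) auto
      also have "\<dots> = measure (distr M (count_space UNIV) S) {j. (real j - m n) / sqrt (V n) \<le> z}"
        using S by (intro measure_distr[symmetric]) auto
      \<comment> \<open>Cutting down to the support makes the event finite, so its probability is a
        sum of masses.\<close>
      also have "\<dots> = measure (measure_pmf (frac_binomial_pmf \<alpha> x n)) {j. j \<le> n \<and> (real j - m n) / sqrt (V n) \<le> z}"
        unfolding distr by (intro measure_pmf.finite_measure_eq_AE) (auto simp: AE_measure_pmf_iff intro: supp)
      also have "\<dots> = (\<Sum>j\<in>{j. j \<le> n \<and> (real j - m n) / sqrt (V n) \<le> z}. p n j)"
        unfolding p_def by (intro measure_measure_pmf_finite) auto
      finally show ?thesis .
    qed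
    have "C / sqrt (real n) \<le> max 1 C / sqrt (real n)" by (intro divide_right_mono) auto
    then show "(SUP z. \<bar>\<P>(\<omega> in M. standardized M (\<lambda>\<omega>. real (S \<omega>)) \<omega> \<le> z) - std_normal_cdf z\<bar>)
        \<le> max 1 C / sqrt (real n)"
      unfolding prob using C n by (intro cSUP_least) (auto intro: order.trans)
  qed simp
qed

end
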